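(* Let $F\in\mathcal{F}[-\pi,\pi]$ and $x\in(-\pi,\pi)$. Then $$\lim_{n\to\infty}\mathrm{haus}\big(\mathscr{S}_nF(x),A_F(x)\big)=0,$$ where $\mathscr{S}_nF$ is the $n$-th term of the metric Fourier series of $F$ and $A_F(x)=\left\{\tfrac12\big(s(x+0)+s(x-0)\big)\ :\ s\in\mathcal{S}(F)\right\}$.
   Context: Fix $d\ge1$ and a norm $|\cdot|$ on $\mathbb{R}^d$. $\mathrm{K}(\mathbb{R}^d)$ is the collection of non-empty compact subsets of $\mathbb{R}^d$. For non-empty $A,B\subset\mathbb{R}^d$, $\mathrm{haus}(A,B)=\max\{\sup_{a\in A}\mathrm{dist}(a,B),\sup_{b\in B}\mathrm{dist}(b,A)\}$ with $\mathrm{dist}(c,D)=\inf_{d\in D}|c-d|$. The total variation of $F:[a,b]\to\mathrm{K}(\mathbb{R}^d)$ is $V_a^b(F)=\sup\sum_{i=1}^n\mathrm{haus}(F(x_i),F(x_{i-1}))$ over all partitions $a=x_0<\dots<x_n=b$. $\mathcal{F}[a,b]$ is the set of all $F:[a,b]\to\mathrm{K}(\mathbb{R}^d)$ with $V_a^b(F)<\infty$ whose graph $\{(x,y): x\in[a,b],\ y\in F(x)\}$ is compact. For $A,B\in\mathrm{K}(\mathbb{R}^d)$, the set of metric pairs is $\Pi(A,B)=\{(a,b)\in A\times B:\ |a-b|=\mathrm{dist}(b,A)\ \text{or}\ |a-b|=\mathrm{dist}(a,B)\}$. A metric chain of $A_0,\dots,A_n$ is a tuple $(a_0,\dots,a_n)$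 with $(a_i,a_{i+1})\in\Pi(A_i,A_{i+1})$, $i=0,\dots,n-1$; $\mathrm{CH}(A_0,\dots,A_n)$ is the set of all metric chains. Given a partition $\chi=\{a=x_0<\dots<x_n=b\}$ with norm $|\chi|=\max_i(x_{i+1}-x_i)$ and a metric chain $\phi=(y_0,\dots,y_n)\in\mathrm{CH}(F(x_0),\dots,F(x_n))$, the chain function $c_{\chi,\phi}:[a,b]\to\mathbb{R}^d$ is $c_{\chi,\phi}(x)=y_i$ for $x\in[x_i,x_{i+1})$, $0\le i\le n-1$, and $c_{\chi,\phi}(x_n)=y_n$. A selection $s$ of $F$ (i.e. $s:[a,b]\to\mathbb{R}^d$, $s(x)\in F(x)$ for all $x$) is a metric selection if there are chain functions $c_{\chi_k,\phi_k}$ of $F$ with $|\chi_k|\to0$ and $s(x)=\lim_{k\to\infty}c_{\chi_k,\phi_k}(x)$ for every $x\in[a,b]$. $\mathcal{S}(F)$ is the set of metric selections of $F$. It is known that every metric selection of $F\in\mathcal{F}[a,b]$ has bounded variation, so the one-sided limits $s(x\pm0)$ exist. For $k:[a,b]\to\mathbb{R}$ and a partition $\chi$, the weighted metric Riemann sum is $(\mathcal{M}_k)S_\chi F=\{\sum_{i=0}^{n-1}(x_{i+1}-x_i)k(x_i)y_i:\ (y_0,\dots,y_{n-1})\in\mathrm{CH}(F(x_0),\dots,F(x_{n-1}))\}$. The weighted metric integral $(\mathcal{M}_k)\int_a^bk(x)F(x)dx$ is the set of all $y\in\mathbb{R}^d$ for which there are partitions $\chi_n$ with $|\chi_n|\to0$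 and points $y_n\in(\mathcal{M}_k)S_{\chi_n}F$ with $y_n\to y$. The Dirichlet kernel is $D_n(x)=\frac12+\sum_{k=1}^n\cos kx$, and $\partial_{n,x}(t)=D_n(x-t)$. The metric Fourier series of $F:[-\pi,\pi]\to\mathrm{K}(\mathbb{R}^d)$ is the sequence of set-valued functions $\mathscr{S}_nF(x)=\frac1\pi(\mathcal{M}_{\partial_{n,x}})\int_{-\pi}^{\pi}\partial_{n,x}(t)F(t)dt$, $x\in[-\pi,\pi]$, $n\in\mathbb{N}$. *)

theory Defs
  imports "HOL-Analysis.Analysis"
begin

text \<open>
  The ambient norm is an arbitrary norm \<open>N\<close> on \<open>real ^ 'd\<close>, in general different from the
  Euclidean norm of the type. Compactness and convergence of points refer to the standard topology,
  which every such \<open>N\<close> induces; distances and the Hausdorff distance refer to \<open>N\<close>.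
\<close>

definition is_norm :: "('v::real_vector \<Rightarrow> real) \<Rightarrow> bool" where
  "is_norm N \<longleftrightarrow>
     (\<forall>v. 0 \<le> N v) \<and> (\<forall>v. N v = 0 \<longleftrightarrow> v = 0) \<and>
     (\<forall>c v. N (c *\<^sub>R v) = \<bar>c\<bar> * N v) \<and> (\<forall>v w. N (v + w) \<le> N v + N w)"

text \<open>
  Extended-real values, so that no supremum or infimum is a default value. The Hausdorff distance is
  finite only for non-empty sets: \<open>haus N {} B = \<infinity>\<close> for non-empty \<open>B\<close>, and \<open>haus N {} {} = -\<infinity>\<close>.
\<close>

definition dist_to :: "('v::real_vector \<Rightarrow> real) \<Rightarrow> 'v \<Rightarrow> 'v set \<Rightarrow> ereal" where
  "dist_to N c D = (INF d\<in>D. ereal (N (c - d)))"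

definition haus :: "('v::real_vector \<Rightarrow> real) \<Rightarrow> 'v set \<Rightarrow> 'v set \<Rightarrow> ereal" where
  "haus N A B = max (SUP a\<in>A. dist_to N a B) (SUP b\<in>B. dist_to N b A)"

text \<open>
  A partition \<open>a = x\<^sub>0 < \<dots> < x\<^sub>n = b\<close> is a number \<open>n\<close> with a function \<open>\<xi>\<close> of which only the values
  \<open>\<xi> 0, \<dots>, \<xi> n\<close> matter; tuples \<open>(y\<^sub>0, \<dots>, y\<^sub>n)\<close> are encoded in the same way.
\<close>

definition is_partition :: "real \<Rightarrow> real \<Rightarrow> nat \<Rightarrow> (nat \<Rightarrow> real) \<Rightarrow> bool" where
  "is_partition a b n \<xi> \<longleftrightarrow> 0 < n \<and> \<xi> 0 = a \<and> \<xi> n = b \<and> (\<forall>i<n. \<xi> i < \<xi> (Suc i))"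

definition mesh :: "nat \<Rightarrow> (nat \<Rightarrow> real) \<Rightarrow> real" where
  "mesh n \<xi> = Max ((\<lambda>i. \<xi> (Suc i) - \<xi> i) ` {..<n})"

definition total_variation ::
    "('v::real_vector \<Rightarrow> real) \<Rightarrow> real \<Rightarrow> real \<Rightarrow> (real \<Rightarrow> 'v set) \<Rightarrow> ereal" where
  "total_variation N a b F =
     (SUP (n, \<xi>) \<in> {(n, \<xi>). is_partition a b n \<xi>}. \<Sum>i=1..n. haus N (F (\<xi> i)) (F (\<xi> (i - 1))))"

text \<open>The class \<open>\<F>[a,b]\<close>; values of \<open>F\<close> outside \<open>{a..b}\<close> are irrelevant.\<close>

definition BV_compact_graph ::
    "('v::real_normed_vector \<Rightarrow> real) \<Rightarrow> real \<Rightarrow> real \<Rightarrow> (real \<Rightarrow> 'v set) set" where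
  "BV_compact_graph N a b =
     {F. (\<forall>x\<in>{a..b}. F x \<noteq> {} \<and> compact (F x)) \<and>
         total_variation N a b F < \<infinity> \<and>
         compact {(x, y). x \<in> {a..b} \<and> y \<in> F x}}"

definition metric_pairs :: "('v::real_vector \<Rightarrow> real) \<Rightarrow> 'v set \<Rightarrow> 'v set \<Rightarrow> ('v \<times> 'v) set" where
  "metric_pairs N A B =
     {(a, b). a \<in> A \<and> b \<in> B \<and>
        (ereal (N (a - b)) = dist_to N b A \<or> ereal (N (a - b)) = dist_to N a B)}"

text \<open>
  \<open>metric_chains N n A\<close> is \<open>CH(A 0, \<dots>, A n)\<close>. Membership is stated separately because of the case
  \<open>n = 0\<close>, where \<open>CH(A 0)\<close> consists of all points of \<open>A 0\<close>.
\<close>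

definition metric_chains ::
    "('v::real_vector \<Rightarrow> real) \<Rightarrow> nat \<Rightarrow> (nat \<Rightarrow> 'v set) \<Rightarrow> (nat \<Rightarrow> 'v) set" where
  "metric_chains N n A =
     {y. (\<forall>i\<le>n. y i \<in> A i) \<and> (\<forall>i<n. (y i, y (Suc i)) \<in> metric_pairs N (A i) (A (Suc i)))}"

definition chain_function :: "nat \<Rightarrow> (nat \<Rightarrow> real) \<Rightarrow> (nat \<Rightarrow> 'v) \<Rightarrow> real \<Rightarrow> 'v" where
  "chain_function n \<xi> y x =
     (if x = \<xi> n then y n else y (THE i. i < n \<and> \<xi> i \<le> x \<and> x < \<xi> (Suc i)))"

definition metric_selections ::
    "('v::real_normed_vector \<Rightarrow> real) \<Rightarrow> real \<Rightarrow> real \<Rightarrow> (real \<Rightarrow> 'v set) \<Rightarrow> (real \<Rightarrow> 'v) set" where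
  "metric_selections N a b F =
     {s. (\<forall>x\<in>{a..b}. s x \<in> F x) \<and>
         (\<exists>m \<xi> y.
            (\<forall>k. is_partition a b (m k) (\<xi> k) \<and> y k \<in> metric_chains N (m k) (\<lambda>i. F (\<xi> k i))) \<and>
            (\<lambda>k. mesh (m k) (\<xi> k)) \<longlonglongrightarrow> 0 \<and>
            (\<forall>x\<in>{a..b}. (\<lambda>k. chain_function (m k) (\<xi> k) (y k) x) \<longlonglongrightarrow> s x))}"

text \<open>The chains run over \<open>F(x\<^sub>0), \<dots>, F(x\<^bsub>n-1\<^esub>)\<close> only, without \<open>F(x\<^sub>n)\<close>.\<close>

definition weighted_metric_sums ::
    "('v::real_vector \<Rightarrow> real) \<Rightarrow> (real \<Rightarrow> real) \<Rightarrow> nat \<Rightarrow> (nat \<Rightarrow> real) \<Rightarrow> (real \<Rightarrow> 'v set) \<Rightarrow> 'v set" where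
  "weighted_metric_sums N w n \<xi> F =
     {(\<Sum>i<n. ((\<xi> (Suc i) - \<xi> i) * w (\<xi> i)) *\<^sub>R y i) | y.
        y \<in> metric_chains N (n - 1) (\<lambda>i. F (\<xi> i))}"

definition weighted_metric_integral ::
    "('v::real_normed_vector \<Rightarrow> real) \<Rightarrow> (real \<Rightarrow> real) \<Rightarrow> real \<Rightarrow> real \<Rightarrow> (real \<Rightarrow> 'v set) \<Rightarrow> 'v set" where
  "weighted_metric_integral N w a b F =
     {z. \<exists>m \<xi> u.
        (\<forall>k. is_partition a b (m k) (\<xi> k) \<and> u k \<in> weighted_metric_sums N w (m k) (\<xi> k) F) \<and>
        (\<lambda>k. mesh (m k) (\<xi> k)) \<longlonglongrightarrow> 0 \<and> u \<longlonglongrightarrow> z}"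

definition Dirichlet_kernel :: "nat \<Rightarrow> real \<Rightarrow> real" where
  "Dirichlet_kernel n x = 1/2 + (\<Sum>k=1..n. cos (real k * x))"

definition metric_Fourier ::
    "('v::real_normed_vector \<Rightarrow> real) \<Rightarrow> (real \<Rightarrow> 'v set) \<Rightarrow> nat \<Rightarrow> real \<Rightarrow> 'v set" where
  "metric_Fourier N F n x =
     (\<lambda>z. (1 / pi) *\<^sub>R z) `
       weighted_metric_integral N (\<lambda>t. Dirichlet_kernel n (x - t)) (- pi) pi F"

text \<open>For \<open>F\<close> in \<open>\<F>[-pi,pi]\<close> the one-sided limits at \<open>-pi < x < pi\<close> exist, since metric selections of
  such \<open>F\<close> have bounded variation.\<close>

definition Fourier_limit_set ::
    "('v::real_normed_vector \<Rightarrow> real) \<Rightarrow> (real \<Rightarrow> 'v set) \<Rightarrow> real \<Rightarrow> 'v set" where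
  "Fourier_limit_set N F x =
     {(1/2) *\<^sub>R (Lim (at_right x) s + Lim (at_left x) s) | s. s \<in> metric_selections N (- pi) pi F}"

end

theory Submission
  imports Defs "HOL-Complex_Analysis.Great_Picard" "HOL-Real_Asymp.Real_Asymp"
begin

text \<open>
  By Helly's selection principle for chain functions and dominated convergence, the weighted metric
  integral of \<open>F\<close> consists exactly of the integrals of the metric selections of \<open>F\<close> against the
  weight; hence \<open>\<S>\<^sub>nF(x)\<close> is the set of the \<open>n\<close>-th partial Fourier sums at \<open>x\<close> of the selections
  \<open>s \<in> \<S>(F)\<close>. All these selections have their increments dominated by those of a single
  increasing function \<open>v\<close> built from the variation of \<open>F\<close>. The Dirichlet-Jordan theorem, proved by
  the second mean value theorem applied to \<open>v\<close> and, for each coordinate, to the increasing function \<open>v - s\<close>, therefore holds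
  at \<open>x\<close> with a rate depending on \<open>v\<close> only, that is, uniformly over \<open>\<S>(F)\<close>.
\<close>

section \<open>The Dirichlet kernel and its primitive\<close>

text \<open>After the integral is identified, \<open>metric_Fourier N F n x\<close> and the limit
  set are images of the same set of selections. Pairing points with equal \<open>s\<close> bounds
  the Hausdorff distance, so a rate common to all selections is what is needed. The L1 norms of the
  Dirichlet kernels are unbounded, so estimates that put absolute values under the integral fail.
  Their primitives do better: they are bounded uniformly in \<open>n\<close> and, away from 0, lie
  within O(1/n) of pi/2. The second mean value theorem expresses integrals of monotone functions
  through these primitives: near 0 a constant multiplies a small oscillation, elsewhere the error is
  O(1/n). The integral is split at \<open>x\<close> into pieces of lengths \<open>pi - x\<close> and
  \<open>x + pi\<close>. One of them may exceed pi, but both stay below 2 pi, so the primitive is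
  estimated up to 2 pi and \<open>F\<close> is never extended periodically. A chain function jumps
  only at nodes, so the variation of \<open>F\<close> controls it only up to a lag of one mesh
  width. This lag shapes both the Helly argument and the choice of \<open>v\<close>.\<close>

definition Dirichlet_primitive :: "nat \<Rightarrow> real \<Rightarrow> real" where
  "Dirichlet_primitive n u = u / 2 + (\<Sum>k=1..n. sin (real k * u) / real k)"

lemma Dirichlet_primitive_deriv:
  "(Dirichlet_primitive n has_real_derivative Dirichlet_kernel n u) (at u within S)"
proof -
  have "((\<lambda>u. u / 2 + (\<Sum>k=1..n. sin (real k * u) / real k)) has_real_derivative
      1 / 2 + (\<Sum>k=1..n. real k * cos (real k * u) / real k)) (at u within S)"
    by (auto intro!: derivative_eq_intros sum.cong)
  moreover have "(\<Sum>k=1..n. real k * cos (real k * u) / real k) = (\<Sum>k=1..n. cos (real k * u))"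
    by (intro sum.cong) auto
  ultimately show ?thesis
    unfolding Dirichlet_kernel_def Dirichlet_primitive_def by simp
qed

lemma Dirichlet_kernel_minus [simp]: "Dirichlet_kernel n (- u) = Dirichlet_kernel n u"
  by (simp add: Dirichlet_kernel_def)

lemma continuous_on_Dirichlet_kernel [continuous_intros]:
  fixes f :: "'a::t2_space \<Rightarrow> real"
  shows "continuous_on S f \<Longrightarrow> continuous_on S (\<lambda>x. Dirichlet_kernel n (f x))"
  unfolding Dirichlet_kernel_def by (intro continuous_intros)

lemma has_integral_Dirichlet_kernel:
  "a \<le> b \<Longrightarrow>
    (Dirichlet_kernel n has_integral (Dirichlet_primitive n b - Dirichlet_primitive n a)) {a..b}"
  using Dirichlet_primitive_deriv
  by (intro fundamental_theorem_of_calculus)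
     (auto simp: has_real_derivative_iff_has_vector_derivative)

text \<open>The closed form of the kernel, multiplied out so that zeros of
  \<open>sin (u / 2)\<close> need no exception. Each cosine contributes a difference of two sines,
  and the sum telescopes.\<close>

lemma Dirichlet_kernel_mult_sin:
  "2 * sin (u / 2) * Dirichlet_kernel n u = sin ((real n + 1 / 2) * u)"
proof (induction n)
  case 0
  then show ?case by (simp add: Dirichlet_kernel_def)
next
  case (Suc n)
  have "2 * sin (u / 2) * cos (real (Suc n) * u) =
      sin (real (Suc n) * u + u / 2) - sin (real (Suc n) * u - u / 2)"
    by (simp add: sin_add sin_diff)
  moreover have "real (Suc n) * u + u / 2 = (real (Suc n) + 1 / 2) * u"
    "real (Suc n) * u - u / 2 = (real n + 1 / 2) * u"
    by (simp_all add: field_simps)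
  ultimately have "2 * sin (u / 2) * cos (real (Suc n) * u) =
      sin ((real (Suc n) + 1 / 2) * u) - sin ((real n + 1 / 2) * u)"
    by simp
  moreover have "Dirichlet_kernel (Suc n) u = Dirichlet_kernel n u + cos (real (Suc n) * u)"
    by (simp add: Dirichlet_kernel_def)
  ultimately show ?case
    using Suc by (simp only: distrib_left)
qed

lemma abs_Dirichlet_kernel_le: "\<bar>Dirichlet_kernel n u\<bar> \<le> real n + 1 / 2"
proof -
  have "\<bar>\<Sum>k=1..n. cos (real k * u)\<bar> \<le> (\<Sum>k=1..n. 1)"
    by (intro sum_abs[THEN order_trans] sum_mono) auto
  then show ?thesis
    unfolding Dirichlet_kernel_def by auto
qed

lemma Dirichlet_primitive_0 [simp]: "Dirichlet_primitive n 0 = 0"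
  by (simp add: Dirichlet_primitive_def)

lemma Dirichlet_primitive_pi [simp]: "Dirichlet_primitive n pi = pi / 2"
  by (simp add: Dirichlet_primitive_def)

lemma Dirichlet_primitive_reflect:
  "Dirichlet_primitive n (2 * pi - u) = pi - Dirichlet_primitive n u"
proof -
  have "sin (real k * (2 * pi - u)) = - sin (real k * u)" for k
    using sin_2npi[of k] cos_2npi[of k]
    by (simp add: right_diff_distrib sin_diff mult_ac)
  then show ?thesis
    by (simp add: Dirichlet_primitive_def sum_negf field_simps)
qed

section \<open>Bounds on the primitive near 0, away from 0, and uniformly in
  \<open>n\<close>\<close>

lemma abs_Dirichlet_primitive_le:
  assumes "0 \<le> u"
  shows "\<bar>Dirichlet_primitive n u\<bar> \<le> (real n + 1 / 2) * u"
proof -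
  have "norm (integral {0..u} (Dirichlet_kernel n)) \<le> (real n + 1 / 2) * (u - 0)"
    using assms abs_Dirichlet_kernel_le
    by (intro integral_bound) (auto intro!: continuous_intros)
  then show ?thesis
    using integral_unique[OF has_integral_Dirichlet_kernel[OF assms, of n]] by simp
qed

text \<open>The value at pi is exactly pi/2, so the deviation at \<open>u\<close> is an oscillating
  integral over \<open>{u..pi}\<close>. The boundary term and the remainder of its integration by
  parts each cost at most \<theta>(u). The restriction to \<open>u \<le> pi\<close> keeps
  \<open>cos (t / 2)\<close> nonnegative.\<close>

lemma Dirichlet_primitive_near_half_pi_aux:
  assumes "0 < u" "u \<le> pi"
  shows "\<bar>Dirichlet_primitive n u - pi / 2\<bar> \<le> 2 / ((2 * real n + 1) * sin (u / 2))"
proof -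
  define p where "p = 2 * real n + 1"
  have p: "p > 0" "real n + 1 / 2 = p / 2" unfolding p_def by auto
  have sin_pos: "sin (t / 2) > 0" if "u \<le> t" "t \<le> pi" for t
    using that assms by (intro sin_gt_zero) auto
  \<comment> \<open>One step of integration by parts in \<open>\<integral> sin (p t / 2) / (2 sin (t / 2)) dt\<close>.\<close>
  define \<Psi> where
    "\<Psi> t = Dirichlet_primitive n t - pi / 2 + cos (p / 2 * t) / (p * sin (t / 2))" for t
  define \<theta> where "\<theta> t = 1 / (p * sin (t / 2))" for t
  have D\<Psi>: "(\<Psi> has_real_derivative
      - (cos (p / 2 * t) * cos (t / 2) / (2 * p * (sin (t / 2))\<^sup>2))) (at t)"
    if t: "u \<le> t" "t \<le> pi" for t
  proof -
    have s: "sin (t / 2) \<noteq> 0" "p \<noteq> 0" using sin_pos[OF t] p by auto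
    have D: "Dirichlet_kernel n t = sin (p / 2 * t) / (2 * sin (t / 2))"
      using Dirichlet_kernel_mult_sin[of t n] s p by (simp add: field_simps)
    show ?thesis
      unfolding \<Psi>_def using s
      by (auto intro!: derivative_eq_intros Dirichlet_primitive_deriv simp: D)
         (simp add: field_simps power2_eq_square)
  qed
  have D\<theta>: "(\<theta> has_real_derivative - (cos (t / 2) / (2 * p * (sin (t / 2))\<^sup>2))) (at t)"
    if t: "u \<le> t" "t \<le> pi" for t
  proof -
    have s: "sin (t / 2) \<noteq> 0" "p \<noteq> 0" using sin_pos[OF t] p by auto
    show ?thesis
      unfolding \<theta>_def using s
      by (auto intro!: derivative_eq_intros) (simp add: field_simps power2_eq_square)
  qed
  have cmp: "\<bar>cos (p / 2 * t) * cos (t / 2) / (2 * p * (sin (t / 2))\<^sup>2)\<bar> \<le>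
      cos (t / 2) / (2 * p * (sin (t / 2))\<^sup>2)" if t: "u \<le> t" "t \<le> pi" for t
  proof -
    have "cos (t / 2) \<ge> 0" using t assms by (intro cos_ge_zero) auto
    then have "\<bar>cos (p / 2 * t)\<bar> * cos (t / 2) \<le> 1 * cos (t / 2)"
      by (intro mult_right_mono) auto
    then show ?thesis
      using \<open>cos (t / 2) \<ge> 0\<close> p by (simp add: abs_mult divide_right_mono)
  qed
  have cospi: "cos (p / 2 * pi) = 0"
  proof -
    have "p / 2 * pi = real n * pi + pi / 2" by (simp add: p_def field_simps)
    then show ?thesis by (simp only: cos_add sin_npi cos_pi_half)
  qed
  have ends: "\<Psi> pi = 0" "\<theta> pi = 1 / p"
    using cospi by (auto simp: \<Psi>_def \<theta>_def)
  \<comment> \<open>By \<open>cmp\<close>, |\<Psi>'| is at most -\<theta>', so both \<theta> +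
    \<Psi> and \<theta> - \<Psi> decrease. At pi both equal \<open>1 / p\<close>, which is positive;
    hence |\<Psi>| is at most \<theta> at \<open>u\<close>.\<close>
  have "\<Psi> pi + \<theta> pi \<le> \<Psi> u + \<theta> u"
  proof (rule DERIV_nonpos_imp_nonincreasing[of u pi "\<lambda>t. \<Psi> t + \<theta> t"])
    fix t assume t: "u \<le> t" "t \<le> pi"
    show "\<exists>y. ((\<lambda>t. \<Psi> t + \<theta> t) has_real_derivative y) (at t) \<and> y \<le> 0"
      by (intro exI conjI, rule DERIV_add[OF D\<Psi>[OF t] D\<theta>[OF t]])
         (use cmp[OF t] in linarith)
  qed (use assms in auto)
  moreover have "\<theta> pi - \<Psi> pi \<le> \<theta> u - \<Psi> u"
  proof (rule DERIV_nonpos_imp_nonincreasing[of u pi "\<lambda>t. \<theta> t - \<Psi> t"])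
    fix t assume t: "u \<le> t" "t \<le> pi"
    show "\<exists>y. ((\<lambda>t. \<theta> t - \<Psi> t) has_real_derivative y) (at t) \<and> y \<le> 0"
      by (intro exI conjI, rule DERIV_diff[OF D\<theta>[OF t] D\<Psi>[OF t]])
         (use cmp[OF t] in linarith)
  qed (use assms in auto)
  ultimately have "\<bar>\<Psi> u\<bar> \<le> \<theta> u"
    using ends p(1) zero_le_divide_1_iff[of p] by linarith
  moreover have "\<bar>cos (p / 2 * u) / (p * sin (u / 2))\<bar> \<le> \<theta> u"
    using sin_pos[of u] assms p unfolding \<theta>_def by (simp add: abs_mult divide_right_mono)
  ultimately have "\<bar>\<Psi> u - cos (p / 2 * u) / (p * sin (u / 2))\<bar> \<le> \<theta> u + \<theta> u"
    by (intro abs_triangle_ineq4[THEN order_trans] add_mono)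
  then show ?thesis by (simp add: \<Psi>_def \<theta>_def p_def mult.commute)
qed

text \<open>The reflection of \<open>u\<close> to \<open>2 * pi - u\<close> preserves
  \<open>sin (u / 2)\<close> and the distance of the primitive from pi/2. The range beyond pi occurs
  when the integral is split at a point other than 0.\<close>

lemma Dirichlet_primitive_near_half_pi:
  assumes "0 < u" "u < 2 * pi"
  shows "\<bar>Dirichlet_primitive n u - pi / 2\<bar> \<le> 2 / ((2 * real n + 1) * sin (u / 2))"
proof (cases "u \<le> pi")
  case True
  then show ?thesis using Dirichlet_primitive_near_half_pi_aux assms by blast
next
  case False
  have "\<bar>Dirichlet_primitive n (2 * pi - u) - pi / 2\<bar> \<le>
      2 / ((2 * real n + 1) * sin ((2 * pi - u) / 2))"
    using False assms by (intro Dirichlet_primitive_near_half_pi_aux) auto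
  moreover have "sin ((2 * pi - u) / 2) = sin (u / 2)"
    by (simp add: diff_divide_distrib)
  ultimately show ?thesis
    by (simp add: Dirichlet_primitive_reflect abs_minus_commute)
qed

text \<open>A weak form of Jordan's inequality, whose sharp constant is 2/pi. Up to pi/3 the cosine
  is at least 1/2; beyond it the sine is at least 3/4, while \<open>y / 3\<close> stays below
  2/3.\<close>

lemma sin_ge_third:
  fixes y :: real
  assumes "0 \<le> y" "y \<le> pi / 2"
  shows "y / 3 \<le> sin y"
proof (cases "y \<le> pi / 3")
  case True
  have "sin 0 - 0 / 2 \<le> sin y - y / 2"
  proof (rule DERIV_nonneg_imp_nondecreasing[of 0 y "\<lambda>y. sin y - y / 2"])
    fix t assume t: "0 \<le> t" "t \<le> y"
    have "cos (pi / 3) \<le> cos t"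
      using t True by (intro cos_monotone_0_pi_le) auto
    then show "\<exists>d. ((\<lambda>y. sin y - y / 2) has_real_derivative d) (at t) \<and> 0 \<le> d"
      by (intro exI[of _ "cos t - 1 / 2"]) (auto intro!: derivative_eq_intros simp: cos_60)
  qed (use assms in auto)
  then show ?thesis using assms by simp
next
  case False
  have "sin (pi / 3) \<le> sin y"
    using False assms by (intro sin_monotone_2pi_le) auto
  moreover have "3 / 2 \<le> sqrt (3::real)" by (intro real_le_rsqrt) (simp add: power2_eq_square)
  ultimately show ?thesis
    using assms pi_less_4 unfolding sin_60 by linarith
qed

text \<open>Up to \<open>u = 2 / (2 * n + 1)\<close> the bound linear in \<open>u\<close> gives 1.
  Beyond that point the primitive differs from pi/2 by at most 6, and pi/2 < 2; this is the origin
  of 8.\<close>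

lemma abs_Dirichlet_primitive_le_8:
  assumes "0 \<le> u" "u \<le> pi"
  shows "\<bar>Dirichlet_primitive n u\<bar> \<le> 8"
proof (cases "(2 * real n + 1) * u \<le> 2")
  case True
  then show ?thesis
    using abs_Dirichlet_primitive_le[OF assms(1), of n] by (simp add: field_simps)
next
  case False
  then have u: "u > 0" using assms by (cases "u = 0") auto
  have "u / 6 \<le> sin (u / 2)"
    using sin_ge_third[of "u / 2"] assms by simp
  then have "(2 * real n + 1) * (u / 6) \<le> (2 * real n + 1) * sin (u / 2)"
    by (intro mult_left_mono) auto
  then have sin_ge: "1 / 3 \<le> (2 * real n + 1) * sin (u / 2)" using False by linarith
  have "2 / ((2 * real n + 1) * sin (u / 2)) \<le> 2 / (1 / 3)"
    using sin_ge by (intro divide_left_mono) auto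
  then have "2 / ((2 * real n + 1) * sin (u / 2)) \<le> 6" by simp
  then show ?thesis
    using Dirichlet_primitive_near_half_pi_aux[OF u assms(2), of n] pi_less_4 pi_gt_zero
    by linarith
qed

section \<open>A uniform Dirichlet-Jordan estimate on one side\<close>

text \<open>The second mean value theorem is applied on \<open>{0..\<delta>}\<close> and on
  \<open>{\<delta>..c}\<close> separately. On the first interval the primitive is merely bounded by
  8, so its differences are at most 16 and multiply the oscillation of \<open>g\<close> there. On
  the second it is close to pi/2. The constant \<open>K\<close> is obtained before \<open>n\<close>,
  \<open>g\<close> and \<open>M\<close>, which makes the estimate uniform.\<close>

lemma Dirichlet_integral_mono:
  fixes g :: "real \<Rightarrow> real"
  assumes \<delta>: "0 < \<delta>" "\<delta> \<le> pi" "\<delta> \<le> c" and c: "c < 2 * pi"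
  obtains K where "\<And>n g M. mono_on {0..c} g \<Longrightarrow> (\<And>u. u \<in> {0..c} \<Longrightarrow> \<bar>g u\<bar> \<le> M) \<Longrightarrow>
    \<exists>I. ((\<lambda>u. g u * Dirichlet_kernel n u) has_integral I) {0..c} \<and>
      \<bar>I - pi / 2 * g 0\<bar> \<le> 16 * (g \<delta> - g 0) + K * M / (2 * real n + 1)"
proof -
  \<comment> \<open>The minimum \<open>m\<close> of \<open>sin (u / 2)\<close> over
    \<open>{\<delta>..c}\<close> is positive because \<open>c < 2 * pi\<close>; it bounds the error
    of the primitive on the whole interval by \<eta>.\<close>
  have "continuous_on {\<delta>..c} (\<lambda>u. sin (u / 2))" by (intro continuous_intros) auto
  then obtain u0 where u0: "u0 \<in> {\<delta>..c}" "\<And>u. u \<in> {\<delta>..c} \<Longrightarrow> sin (u0 / 2) \<le> sin (u / 2)"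
    using continuous_attains_inf[of "{\<delta>..c}" "\<lambda>u. sin (u / 2)"] \<delta> by auto
  define m where "m = sin (u0 / 2)"
  have m: "m > 0" unfolding m_def using u0(1) \<delta> c by (intro sin_gt_zero) auto
  show thesis
  proof (rule that[of "10 / m"])
    fix n :: nat and g :: "real \<Rightarrow> real" and M
    assume g: "mono_on {0..c} g" and M: "\<And>u. u \<in> {0..c} \<Longrightarrow> \<bar>g u\<bar> \<le> M"
    let ?P = "Dirichlet_primitive n" and ?D = "Dirichlet_kernel n"
    define \<eta> where "\<eta> = 2 / ((2 * real n + 1) * m)"
    have near: "\<bar>?P u - pi / 2\<bar> \<le> \<eta>" if u: "u \<in> {\<delta>..c}" for u
    proof -
      have "\<bar>?P u - pi / 2\<bar> \<le> 2 / ((2 * real n + 1) * sin (u / 2))"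
        using u \<delta> c by (intro Dirichlet_primitive_near_half_pi) auto
      also have "\<dots> \<le> \<eta>"
        unfolding \<eta>_def using u0(2)[OF u] m
        by (intro divide_left_mono mult_left_mono mult_pos_pos) (auto simp: m_def)
      finally show ?thesis .
    qed
    have int: "integral {a..b} ?D = ?P b - ?P a" "?D integrable_on {a..b}" if "a \<le> b" for a b
      using has_integral_Dirichlet_kernel[OF that, of n] by (auto intro: integral_unique)
    have g': "g x \<le> g y" if "0 \<le> x" "x \<le> y" "y \<le> c" for x y
      using mono_onD[OF g, of x y] that by auto
    obtain p where p: "p \<in> {0..\<delta>}" and Ip: "((\<lambda>u. g u * ?D u) has_integral
        (g 0 * integral {0..p} ?D + g \<delta> * integral {p..\<delta>} ?D)) {0..\<delta>}"
      using second_mean_value_theorem_full[OF int(2)[of 0 \<delta>], of g] g' \<delta> by auto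
    obtain q where q: "q \<in> {\<delta>..c}" and Iq: "((\<lambda>u. g u * ?D u) has_integral
        (g \<delta> * integral {\<delta>..q} ?D + g c * integral {q..c} ?D)) {\<delta>..c}"
      using second_mean_value_theorem_full[OF int(2)[of \<delta> c], of g] g' \<delta> by auto
    define I where "I = g 0 * ?P p + g \<delta> * (?P \<delta> - ?P p) +
      (g \<delta> * (?P q - ?P \<delta>) + g c * (?P c - ?P q))"
    have "((\<lambda>u. g u * ?D u) has_integral I) {0..c}"
      using has_integral_combine[OF _ _ Ip Iq] p q \<delta> int(1) unfolding I_def by simp
    moreover have "\<bar>I - pi / 2 * g 0\<bar> \<le> 16 * (g \<delta> - g 0) + 5 * (\<eta> * M)"
    proof -
      \<comment> \<open>Regrouped so that, apart from the oscillation term, five products of a value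
        of \<open>g\<close> with a deviation from pi/2 remain. Each is at most
        \<open>\<eta> * M\<close>, and five times \<open>2 / m\<close> is the constant
        \<open>10 / m\<close>.\<close>
      have eq: "I - pi / 2 * g 0 = g 0 * (?P \<delta> - pi / 2) + (g \<delta> - g 0) * (?P \<delta> - ?P p) +
          g \<delta> * (?P q - pi / 2) - g \<delta> * (?P \<delta> - pi / 2) +
          g c * (?P c - pi / 2) - g c * (?P q - pi / 2)"
        unfolding I_def by (simp add: algebra_simps)
      have b: "\<bar>g u * (?P w - pi / 2)\<bar> \<le> \<eta> * M" if "u \<in> {0..c}" "w \<in> {\<delta>..c}" for u w
        using mult_mono[OF near[OF that(2)] M[OF that(1)]] near[OF that(2)]
        by (simp add: abs_mult mult.commute)
      have "\<bar>?P \<delta> - ?P p\<bar> \<le> 16"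
        using abs_Dirichlet_primitive_le_8[of \<delta> n] abs_Dirichlet_primitive_le_8[of p n] \<delta> p by auto
      then have "\<bar>(g \<delta> - g 0) * (?P \<delta> - ?P p)\<bar> \<le> (g \<delta> - g 0) * 16"
        unfolding abs_mult using g'[of 0 \<delta>] \<delta> by (intro mult_mono) auto
      then show ?thesis
        using b[of 0 \<delta>] b[of \<delta> q] b[of \<delta> \<delta>] b[of c c] b[of c q] q \<delta> unfolding eq by auto
    qed
    moreover have "5 * (\<eta> * M) = 10 / m * M / (2 * real n + 1)"
      by (simp add: \<eta>_def field_simps)
    ultimately show "\<exists>I. ((\<lambda>u. g u * ?D u) has_integral I) {0..c} \<and>
        \<bar>I - pi / 2 * g 0\<bar> \<le> 16 * (g \<delta> - g 0) + 10 / m * M / (2 * real n + 1)" by auto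
  qed
qed

text \<open>Here \<open>f\<close> is the difference of \<open>v\<close> and \<open>v - f\<close>,
  both increasing, and \<delta> depends on \<open>v\<close> alone. The quantifier over
  \<open>f\<close> stands inside \<open>eventually\<close>, so one threshold for \<open>n\<close>
  serves every \<open>f\<close> dominated by \<open>v\<close>.\<close>

lemma Dirichlet_integral_uniform_closed:
  fixes v :: "real \<Rightarrow> real"
  assumes c: "0 < c" "c < 2 * pi" and v: "mono_on {0..c} v" "(v \<longlongrightarrow> v 0) (at_right 0)"
    and "0 < \<epsilon>"
  shows "\<forall>\<^sub>F n in sequentially. \<forall>f.
    (\<forall>u\<in>{0..c}. \<bar>f u\<bar> \<le> M) \<and> (\<forall>t u. 0 \<le> t \<and> t < u \<and> u \<le> c \<longrightarrow> \<bar>f t - f u\<bar> \<le> v u - v t) \<longrightarrow>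
    (\<exists>I. ((\<lambda>u. f u * Dirichlet_kernel n u) has_integral I) {0..c} \<and> \<bar>I - pi / 2 * f 0\<bar> \<le> \<epsilon>)"
proof -
  \<comment> \<open>The oscillation enters with factor 16 for \<open>v\<close> and 32 for
    \<open>v - f\<close>, whose increments are at most twice those of \<open>v\<close>. The total of
    48 times \<open>\<epsilon> / 96\<close> is half of \<epsilon>; the O(1/n) terms take the other
    half.\<close>
  have "\<forall>\<^sub>F u in at_right 0. v u < v 0 + \<epsilon> / 96"
    using v(2) \<open>0 < \<epsilon>\<close> by (intro order_tendstoD) auto
  moreover have "\<forall>\<^sub>F u in at_right 0. u \<in> {0<..<min pi c}"
    using c by (intro eventually_at_right_real) auto
  ultimately have "\<forall>\<^sub>F u in at_right 0. v u < v 0 + \<epsilon> / 96 \<and> u \<in> {0<..<min pi c}"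
    by eventually_elim auto
  then have "\<exists>u. v u < v 0 + \<epsilon> / 96 \<and> u \<in> {0<..<min pi c}"
    by (rule eventually_happens'[OF trivial_limit_at_right_real])
  then obtain \<delta> where \<delta>: "0 < \<delta>" "\<delta> \<le> pi" "\<delta> \<le> c" "v \<delta> < v 0 + \<epsilon> / 96"
    by auto
  obtain K where K: "\<And>n g M. mono_on {0..c} g \<Longrightarrow> (\<And>u. u \<in> {0..c} \<Longrightarrow> \<bar>g u\<bar> \<le> M) \<Longrightarrow>
    \<exists>I. ((\<lambda>u. g u * Dirichlet_kernel n u) has_integral I) {0..c} \<and>
      \<bar>I - pi / 2 * g 0\<bar> \<le> 16 * (g \<delta> - g 0) + K * M / (2 * real n + 1)"
    by (rule Dirichlet_integral_mono[OF \<delta>(1-3) c(2)]) blast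
  define Mv where "Mv = max \<bar>v 0\<bar> \<bar>v c\<bar>"
  have Mv: "\<bar>v u\<bar> \<le> Mv" if "u \<in> {0..c}" for u
    using mono_onD[OF v(1), of 0 u] mono_onD[OF v(1), of u c] that unfolding Mv_def by auto
  have "(\<lambda>n. K * Mv / (2 * real n + 1) + K * (Mv + M) / (2 * real n + 1)) \<longlonglongrightarrow> 0"
    by real_asymp
  then have "\<forall>\<^sub>F n in sequentially.
      K * Mv / (2 * real n + 1) + K * (Mv + M) / (2 * real n + 1) < \<epsilon> / 2"
    using \<open>0 < \<epsilon>\<close> by (intro order_tendstoD) auto
  then show ?thesis
  proof (eventually_elim, intro allI impI)
    fix n f
    let ?D = "Dirichlet_kernel n"
    assume n: "K * Mv / (2 * real n + 1) + K * (Mv + M) / (2 * real n + 1) < \<epsilon> / 2"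
      and f: "(\<forall>u\<in>{0..c}. \<bar>f u\<bar> \<le> M) \<and>
        (\<forall>t u. 0 \<le> t \<and> t < u \<and> u \<le> c \<longrightarrow> \<bar>f t - f u\<bar> \<le> v u - v t)"
    have "mono_on {0..c} (\<lambda>u. v u - f u)"
    proof (rule mono_onI)
      fix r s assume "r \<in> {0..c}" "s \<in> {0..c}" "r \<le> s"
      then show "v r - f r \<le> v s - f s"
        using f[THEN conjunct2, rule_format, of r s] by (cases "r = s") auto
    qed
    moreover have "\<bar>v u - f u\<bar> \<le> Mv + M" if "u \<in> {0..c}" for u
      using f Mv[OF that] that by (intro order_trans[OF abs_triangle_ineq4 add_mono]) auto
    ultimately obtain J where J: "((\<lambda>u. (v u - f u) * ?D u) has_integral J) {0..c}"
      "\<bar>J - pi / 2 * (v 0 - f 0)\<bar> \<le>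
        16 * ((v \<delta> - f \<delta>) - (v 0 - f 0)) + K * (Mv + M) / (2 * real n + 1)"
      using K[of "\<lambda>u. v u - f u" "Mv + M" n] by blast
    obtain I where I: "((\<lambda>u. v u * ?D u) has_integral I) {0..c}"
      "\<bar>I - pi / 2 * v 0\<bar> \<le> 16 * (v \<delta> - v 0) + K * Mv / (2 * real n + 1)"
      using K[of v Mv n] v(1) Mv by blast
    have "((\<lambda>u. f u * ?D u) has_integral (I - J)) {0..c}"
      using has_integral_diff[OF I(1) J(1)] by (simp add: field_simps)
    moreover have "\<bar>(I - J) - pi / 2 * f 0\<bar> \<le> \<epsilon>"
    proof -
      have "\<bar>f 0 - f \<delta>\<bar> \<le> v \<delta> - v 0" using f \<delta> by auto
      then have "\<bar>X - Y\<bar> \<le> \<epsilon>" if "\<bar>X\<bar> \<le> 16 * (v \<delta> - v 0) + T"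
        "\<bar>Y\<bar> \<le> 16 * ((v \<delta> - f \<delta>) - (v 0 - f 0)) + T'" "T + T' < \<epsilon> / 2" for X Y T T'
      proof -
        have "\<bar>Y\<bar> \<le> 32 * (v \<delta> - v 0) + T'"
          using that(2) \<open>\<bar>f 0 - f \<delta>\<bar> \<le> v \<delta> - v 0\<close> by (simp add: abs_le_iff)
        with that(1) have "\<bar>X\<bar> + \<bar>Y\<bar> \<le> 48 * (v \<delta> - v 0) + (T + T')" by simp
        also have "\<dots> \<le> \<epsilon>" using that(3) \<delta>(4) by simp
        finally show ?thesis using abs_triangle_ineq4[of X Y] by linarith
      qed
      from this[OF I(2) J(2) n] show ?thesis by (simp add: field_simps)
    qed
    ultimately show "\<exists>I. ((\<lambda>u. f u * ?D u) has_integral I) {0..c} \<and> \<bar>I - pi / 2 * f 0\<bar> \<le> \<epsilon>"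
      by blast
  qed
qed

lemma mono_on_tendsto_at_right:
  fixes v :: "real \<Rightarrow> real"
  assumes c: "0 < c" and v: "mono_on {0<..c} v" and M: "\<And>u. u \<in> {0<..c} \<Longrightarrow> \<bar>v u\<bar> \<le> M"
  obtains l where "(v \<longlongrightarrow> l) (at_right 0)" "\<And>u. u \<in> {0<..c} \<Longrightarrow> l \<le> v u"
proof -
  define l where "l = Inf (v ` {0<..c})"
  have bdd: "bdd_below (v ` {0<..c})"
    using M by (intro bdd_belowI2[of _ "- M"]) (auto simp: abs_le_iff minus_le_iff)
  have le: "l \<le> v u" if "u \<in> {0<..c}" for u
    unfolding l_def using bdd that by (intro cInf_lower) auto
  have "(v \<longlongrightarrow> l) (at_right 0)"
  proof (rule order_tendstoI)
    fix a assume "a < l"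
    then show "\<forall>\<^sub>F u in at_right 0. a < v u"
      using eventually_at_right_real[OF c] le by (auto elim!: eventually_mono intro: less_le_trans)
  next
    fix a assume "l < a"
    then obtain d where d: "d \<in> {0<..c}" "v d < a"
      unfolding l_def using c bdd by (subst (asm) cInf_less_iff) auto
    have "v u < a" if "u \<in> {0<..<d}" for u
      using mono_onD[OF v, of u d] that d by auto
    then show "\<forall>\<^sub>F u in at_right 0. v u < a"
      using eventually_at_right_real[of 0 d] d by (auto elim!: eventually_mono)
  qed
  then show thesis using le that by blast
qed

text \<open>Removes the continuity of \<open>v\<close> at 0. Replacing the values of
  \<open>v\<close> and \<open>f\<close> at 0 by their right limits leaves the integral unchanged and
  reduces to the closed case. This is what produces one-sided limits in the Fourier limit.\<close>

lemma Dirichlet_integral_uniform: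
  fixes v :: "real \<Rightarrow> real"
  assumes c: "0 < c" "c < 2 * pi"
    and v: "mono_on {0<..c} v" "\<And>u. u \<in> {0<..c} \<Longrightarrow> \<bar>v u\<bar> \<le> B"
    and "0 < \<epsilon>"
  shows "\<forall>\<^sub>F n in sequentially. \<forall>f.
    (\<forall>u\<in>{0<..c}. \<bar>f u\<bar> \<le> M) \<and> (\<forall>t u. 0 < t \<and> t < u \<and> u \<le> c \<longrightarrow> \<bar>f t - f u\<bar> \<le> v u - v t) \<longrightarrow>
    (\<exists>I l. ((\<lambda>u. f u * Dirichlet_kernel n u) has_integral I) {0..c} \<and>
      (f \<longlongrightarrow> l) (at_right 0) \<and> \<bar>I - pi / 2 * l\<bar> \<le> \<epsilon>)"
proof -
  obtain l where l: "(v \<longlongrightarrow> l) (at_right 0)" "\<And>u. u \<in> {0<..c} \<Longrightarrow> l \<le> v u"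
    using mono_on_tendsto_at_right[OF c(1) v] by blast
  define v' where "v' = v(0 := l)"
  have mono: "mono_on {0..c} v'"
    using l(2) v(1) by (auto simp: v'_def mono_on_def)
  have "(v' \<longlongrightarrow> l) (at_right 0)"
    using l(1) unfolding v'_def
    by (rule Lim_transform_eventually) (auto simp: eventually_at_filter)
  then have lim: "(v' \<longlongrightarrow> v' 0) (at_right 0)" by (simp add: v'_def)
  show ?thesis
    using Dirichlet_integral_uniform_closed[OF c mono lim \<open>0 < \<epsilon>\<close>, of M]
  proof (eventually_elim, intro allI impI)
    fix n f
    let ?D = "Dirichlet_kernel n"
    assume *: "\<forall>f. (\<forall>u\<in>{0..c}. \<bar>f u\<bar> \<le> M) \<and>
        (\<forall>t u. 0 \<le> t \<and> t < u \<and> u \<le> c \<longrightarrow> \<bar>f t - f u\<bar> \<le> v' u - v' t) \<longrightarrow>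
        (\<exists>I. ((\<lambda>u. f u * ?D u) has_integral I) {0..c} \<and> \<bar>I - pi / 2 * f 0\<bar> \<le> \<epsilon>)"
      and f: "(\<forall>u\<in>{0<..c}. \<bar>f u\<bar> \<le> M) \<and>
        (\<forall>t u. 0 < t \<and> t < u \<and> u \<le> c \<longrightarrow> \<bar>f t - f u\<bar> \<le> v u - v t)"
    \<comment> \<open>Monotonicity of \<open>v - f\<close> gives it a right limit at 0, and with
      that of \<open>v\<close> also one for \<open>f\<close>.\<close>
    have "mono_on {0<..c} (\<lambda>u. v u - f u)"
    proof (rule mono_onI)
      fix r s assume "r \<in> {0<..c}" "s \<in> {0<..c}" "r \<le> s"
      then show "v r - f r \<le> v s - f s"
        using f[THEN conjunct2, rule_format, of r s] by (cases "r = s") auto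
    qed
    moreover have "\<bar>v u - f u\<bar> \<le> B + M" if "u \<in> {0<..c}" for u
      using f v(2)[OF that] that by (intro order_trans[OF abs_triangle_ineq4 add_mono]) auto
    ultimately obtain l' where l': "((\<lambda>u. v u - f u) \<longlongrightarrow> l') (at_right 0)"
      by (rule mono_on_tendsto_at_right[OF c(1)])
    define k where "k = l - l'"
    have k: "(f \<longlongrightarrow> k) (at_right 0)"
      using tendsto_diff[OF l(1) l'] by (simp add: k_def)
    define f' where "f' = f(0 := k)"
    have near: "\<forall>\<^sub>F t in at_right 0. 0 < t \<and> t < u" if "0 < u" for u :: real
      using eventually_at_right_real[OF that] by simp
    have "\<bar>k\<bar> \<le> M"
      using tendsto_rabs[OF k] near[OF c(1)] f
      by (intro tendsto_upperbound) (auto elim!: eventually_mono)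
    \<comment> \<open>Letting \<open>t\<close> decrease to 0 in the increment bound extends it to
      the new values at 0.\<close>
    moreover have "\<bar>k - f u\<bar> \<le> v u - l" if u: "0 < u" "u \<le> c" for u
    proof (rule tendsto_le[OF trivial_limit_at_right_real])
      show "((\<lambda>t. v u - v t) \<longlongrightarrow> v u - l) (at_right 0)" by (intro tendsto_intros l)
      show "((\<lambda>t. \<bar>f t - f u\<bar>) \<longlongrightarrow> \<bar>k - f u\<bar>) (at_right 0)" by (intro tendsto_intros k)
      show "\<forall>\<^sub>F t in at_right 0. \<bar>f t - f u\<bar> \<le> v u - v t"
        using near[OF u(1)] f u(2) by (auto elim!: eventually_mono)
    qed
    ultimately obtain I where I: "((\<lambda>u. f' u * ?D u) has_integral I) {0..c}"
      "\<bar>I - pi / 2 * f' 0\<bar> \<le> \<epsilon>"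
      using *[rule_format, of f'] f unfolding f'_def v'_def by force
    have "((\<lambda>u. f u * ?D u) has_integral I) {0..c}"
      by (rule has_integral_spike_finite[OF _ _ I(1), of "{0}"]) (auto simp: f'_def)
    then show "\<exists>I l. ((\<lambda>u. f u * ?D u) has_integral I) {0..c} \<and>
        (f \<longlongrightarrow> l) (at_right 0) \<and> \<bar>I - pi / 2 * l\<bar> \<le> \<epsilon>"
      using I(2) k by (auto simp: f'_def)
  qed
qed

section \<open>Norms and the Hausdorff distance\<close>

lemma is_normD:
  assumes "is_norm N"
  shows "0 \<le> N v" "N v = 0 \<longleftrightarrow> v = 0" "N (c *\<^sub>R v) = \<bar>c\<bar> * N v" "N (v + w) \<le> N v + N w"
    "N (v - w) = N (w - v)"
proof -
  show N: "0 \<le> N v" "N v = 0 \<longleftrightarrow> v = 0" "N (c *\<^sub>R v) = \<bar>c\<bar> * N v" "N (v + w) \<le> N v + N w" for v w c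
    using assms unfolding is_norm_def by auto
  show "N (v - w) = N (w - v)" using N(3)[of "- 1" "v - w"] by simp
qed

lemma is_norm_le_norm:
  fixes N :: "'v::euclidean_space \<Rightarrow> real"
  assumes N: "is_norm N"
  obtains K where "K > 0" "\<And>v. N v \<le> K * norm v"
proof (rule that[of "1 + (\<Sum>b\<in>Basis. N b)"])
  show "0 < 1 + (\<Sum>b\<in>Basis. N b)"
    using is_normD(1)[OF N] by (intro add_pos_nonneg sum_nonneg) auto
  have sum: "N (\<Sum>b\<in>B. f b) \<le> (\<Sum>b\<in>B. N (f b))" if "finite B" for B :: "'v set" and f
    using that
  proof induction
    case empty
    then show ?case using is_normD(2)[OF N, of 0] by simp
  next
    case (insert b B)
    then show ?case using is_normD(4)[OF N, of "f b" "\<Sum>b\<in>B. f b"] by simp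
  qed
  fix v :: 'v
  have "N v = N (\<Sum>b\<in>Basis. (v \<bullet> b) *\<^sub>R b)" by (simp add: euclidean_representation)
  also have "\<dots> \<le> (\<Sum>b\<in>Basis. \<bar>v \<bullet> b\<bar> * N b)"
    using sum[of Basis "\<lambda>b. (v \<bullet> b) *\<^sub>R b"] by (simp add: is_normD(3)[OF N])
  also have "\<dots> \<le> (\<Sum>b\<in>Basis. norm v * N b)"
    by (intro sum_mono mult_right_mono is_normD(1)[OF N]) (rule Basis_le_norm)
  also have "\<dots> \<le> (1 + (\<Sum>b\<in>Basis. N b)) * norm v"
    by (simp add: sum_distrib_left algebra_simps)
  finally show "N v \<le> (1 + (\<Sum>b\<in>Basis. N b)) * norm v" .
qed

lemma continuous_on_is_norm:
  fixes N :: "'v::euclidean_space \<Rightarrow> real"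
  assumes N: "is_norm N"
  shows "continuous_on S N"
proof -
  obtain K where K: "K > 0" "\<And>v. N v \<le> K * norm v" using is_norm_le_norm[OF N] by blast
  have "\<bar>N v - N w\<bar> \<le> K * norm (v - w)" for v w
    using is_normD(4)[OF N, of w "v - w"] is_normD(4)[OF N, of v "w - v"] is_normD(5)[OF N, of v w]
      K(2)[of "v - w"] by auto
  then have "K-lipschitz_on S N"
    using K(1) by (intro lipschitz_onI) (auto simp: dist_norm)
  then show ?thesis by (rule lipschitz_on_continuous_on)
qed

lemma norm_le_is_norm:
  fixes N :: "'v::euclidean_space \<Rightarrow> real"
  assumes N: "is_norm N"
  obtains K where "K > 0" "\<And>v. norm v \<le> K * N v"
proof -
  have "sphere (0::'v) 1 \<noteq> {}" by (simp add: sphere_eq_empty)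
  then obtain u where u: "u \<in> sphere (0::'v) 1" "\<And>w. w \<in> sphere 0 1 \<Longrightarrow> N u \<le> N w"
    using continuous_attains_inf[OF compact_sphere _ continuous_on_is_norm[OF N]] by blast
  have pos: "N u > 0"
    using u(1) is_normD(1,2)[OF N, of u] by (cases "u = 0") auto
  show thesis
  proof (rule that[of "1 / N u"])
    fix v :: 'v
    show "norm v \<le> 1 / N u * N v"
    proof (cases "v = 0")
      case False
      then have "N u \<le> N ((1 / norm v) *\<^sub>R v)" by (intro u) simp
      then show ?thesis using False pos is_normD(3)[OF N, of "1 / norm v" v] by (simp add: field_simps)
    qed (use is_normD(1)[OF N] pos in auto)
  qed (use pos in auto)
qed

section \<open>Nearest points and the Hausdorff distance\<close>

lemma dist_to_attained:
  fixes N :: "'v::euclidean_space \<Rightarrow> real"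
  assumes N: "is_norm N" and B: "compact B" "B \<noteq> {}"
  obtains b where "b \<in> B" "dist_to N a B = ereal (N (a - b))"
proof -
  have "continuous_on B (\<lambda>b. N (a - b))"
    by (intro continuous_on_compose2[OF continuous_on_is_norm[OF N, of UNIV]] continuous_intros) auto
  then obtain b where b: "b \<in> B" "\<And>c. c \<in> B \<Longrightarrow> N (a - b) \<le> N (a - c)"
    using continuous_attains_inf[OF B] by blast
  then have "dist_to N a B = ereal (N (a - b))"
    unfolding dist_to_def by (intro antisym INF_lower INF_greatest) auto
  with b(1) show thesis by (rule that)
qed

lemma haus_commute: "haus N A B = haus N B A"
  by (simp add: haus_def max.commute)

lemma haus_nonneg:
  assumes N: "is_norm N" and "A \<noteq> {}"
  shows "0 \<le> haus N A B"
proof -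
  obtain a where "a \<in> A" using assms by blast
  moreover have "0 \<le> dist_to N a B"
    unfolding dist_to_def using is_normD(1)[OF N] by (intro INF_greatest) auto
  ultimately show ?thesis
    unfolding haus_def by (intro max.coboundedI1) (rule SUP_upper2)
qed

lemma metric_pairs_le_haus:
  assumes "(a, b) \<in> metric_pairs N A B"
  shows "ereal (N (a - b)) \<le> haus N A B"
proof -
  have "a \<in> A" "b \<in> B" "ereal (N (a - b)) = dist_to N b A \<or> ereal (N (a - b)) = dist_to N a B"
    using assms by (auto simp: metric_pairs_def)
  then show ?thesis
    unfolding haus_def by (metis SUP_upper max.coboundedI1 max.coboundedI2)
qed

text \<open>The point with the same index \<open>s\<close> serves as competitor in both one-sided
  distances, so neither compactness nor closedness of the images enters.\<close>

lemma haus_image_le: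
  assumes N: "is_norm N" and "\<And>s. s \<in> S \<Longrightarrow> N (f s - g s) \<le> \<epsilon>"
  shows "haus N (f ` S) (g ` S) \<le> ereal \<epsilon>"
proof -
  have "dist_to N (f s) (g ` S) \<le> ereal \<epsilon>" "dist_to N (g s) (f ` S) \<le> ereal \<epsilon>" if "s \<in> S" for s
    unfolding dist_to_def using that assms(2)[OF that] is_normD(5)[OF N, of "f s" "g s"]
    by (auto intro!: INF_lower2)
  then show ?thesis unfolding haus_def by (auto intro!: SUP_least)
qed

text \<open>\<open>V\<close> is the variation of \<open>F\<close> over \<open>{a..t}\<close>.
  Appending \<open>t'\<close> to a partition of \<open>{a..t}\<close> adds exactly
  \<open>haus N (F t) (F t')\<close>, so the Hausdorff distance is bounded by the increment.\<close>

lemma BV_variation_function: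
  assumes N: "is_norm N" and F: "F \<in> BV_compact_graph N a b" and "a < b"
  obtains V :: "real \<Rightarrow> real" where "mono V"
    "\<And>t t'. a \<le> t \<Longrightarrow> t < t' \<Longrightarrow> t' \<le> b \<Longrightarrow> haus N (F t) (F t') \<le> ereal (V t' - V t)"
proof -
  \<comment> \<open>Unlike \<open>is_partition\<close>, this admits \<open>n = 0\<close>, so that
    \<open>S a\<close> is non-empty and \<open>W a\<close> is not a supremum over the empty
    set.\<close>
  define S where "S t = {(n, \<xi>). \<xi> 0 = a \<and> \<xi> n = t \<and> (\<forall>i<n. \<xi> i < \<xi> (Suc i))}" for t
  define L where "L n \<xi> = (\<Sum>i<n. haus N (F (\<xi> (Suc i))) (F (\<xi> i)))" for n \<xi>
  define W where "W t = (SUP (n, \<xi>)\<in>S t. L n \<xi>)" for t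
  have S: "S t \<noteq> {}" if "a \<le> t" for t
  proof (cases "a = t")
    case True
    then have "(0, \<lambda>_. a) \<in> S t" by (auto simp: S_def)
    then show ?thesis by blast
  next
    case False
    then have "(1, \<lambda>i. if i = 0 then a else t) \<in> S t" using that by (auto simp: S_def)
    then show ?thesis by blast
  qed
  have step: "W t + haus N (F t) (F t') \<le> W t'" if t: "a \<le> t" "t < t'" "t' \<le> b" for t t'
  proof -
    have h: "0 \<le> haus N (F t) (F t')"
      using F t by (intro haus_nonneg[OF N]) (auto simp: BV_compact_graph_def)
    have "W t + haus N (F t) (F t') = (SUP p\<in>S t. (case p of (n, \<xi>) \<Rightarrow> L n \<xi>) + haus N (F t) (F t'))"
      unfolding W_def using h S[OF t(1)] by (subst SUP_ereal_add_left) auto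
    also have "\<dots> \<le> W t'"
    proof (rule SUP_least, clarify)
      fix n \<xi> assume "(n, \<xi>) \<in> S t"
      then have \<xi>: "\<xi> 0 = a" "\<xi> n = t" "\<forall>i<n. \<xi> i < \<xi> (Suc i)" by (auto simp: S_def)
      have "(Suc n, \<xi>(Suc n := t')) \<in> S t'"
        using \<xi> t by (auto simp: S_def less_Suc_eq)
      moreover have "L (Suc n) (\<xi>(Suc n := t')) = L n \<xi> + haus N (F t) (F t')"
        using \<xi>(2) unfolding L_def by (auto simp: haus_commute intro!: sum.cong arg_cong2[of _ _ _ _ "(+)"])
      ultimately show "L n \<xi> + haus N (F t) (F t') \<le> W t'"
        unfolding W_def by (intro SUP_upper2[of "(Suc n, \<xi>(Suc n := t'))"]) auto
    qed
    finally show ?thesis .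
  qed
  have Wb: "W b < \<infinity>"
  proof -
    have "W b \<le> total_variation N a b F"
      unfolding W_def total_variation_def
    proof (rule SUP_mono, clarify)
      fix n \<xi> assume "(n, \<xi>) \<in> S b"
      then have "is_partition a b n \<xi>" using \<open>a < b\<close> by (cases n) (auto simp: S_def is_partition_def)
      moreover have "L n \<xi> = (\<Sum>i=1..n. haus N (F (\<xi> i)) (F (\<xi> (i - 1))))"
        unfolding L_def by (rule sum.reindex_bij_witness[of _ "\<lambda>i. i - 1" Suc]) auto
      ultimately show "\<exists>m\<in>{(n, \<xi>). is_partition a b n \<xi>}. L n \<xi> \<le>
          (case m of (n, \<xi>) \<Rightarrow> \<Sum>i=1..n. haus N (F (\<xi> i)) (F (\<xi> (i - 1))))"
        by (intro bexI[of _ "(n, \<xi>)"]) auto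
    qed
    also have "\<dots> < \<infinity>" using F by (auto simp: BV_compact_graph_def)
    finally show ?thesis .
  qed
  have h: "0 \<le> haus N (F t) (F t')" if "a \<le> t" "t \<le> b" for t t'
    using F that by (intro haus_nonneg[OF N]) (auto simp: BV_compact_graph_def)
  have mono: "W t \<le> W t'" if "a \<le> t" "t \<le> t'" "t' \<le> b" for t t'
  proof (cases "t = t'")
    case False
    then have "W t + haus N (F t) (F t') \<le> W t'" using step that by auto
    then show ?thesis using h[of t t'] that by (meson add_increasing2 le_less_trans not_le order_trans order_refl)
  qed auto
  have "0 \<le> W a"
  proof -
    have "(0, \<lambda>_. a) \<in> S a" by (auto simp: S_def)
    then show ?thesis unfolding W_def by (rule SUP_upper2) (simp add: L_def)
  qed
  then have nonneg: "0 \<le> W t" if "a \<le> t" "t \<le> b" for t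
    using mono[of a t] that by auto
  have fin: "\<bar>W t\<bar> \<noteq> \<infinity>" if "a \<le> t" "t \<le> b" for t
    using nonneg[of t] mono[of t b] Wb that by auto
  \<comment> \<open>Clamping the argument makes \<open>V\<close> monotone on the whole line. Later
    it is evaluated at \<open>t - mesh n \<xi>\<close>, which may lie to the left of
    \<open>a\<close>.\<close>
  define V where "V t = real_of_ereal (W (max a (min b t)))" for t
  show thesis
  proof (rule that[of V])
    show "mono V"
      unfolding V_def using \<open>a < b\<close>
      using fin nonneg by (intro monoI real_of_ereal_positive_mono mono) auto
  next
    fix t t' assume t: "a \<le> t" "t < t'" "t' \<le> b"
    then have "V t = real_of_ereal (W t)" "V t' = real_of_ereal (W t')" by (auto simp: V_def max_def)
    then have "W t = ereal (V t)" "W t' = ereal (V t')"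
      using fin t by (auto simp: ereal_real)
    then show "haus N (F t) (F t') \<le> ereal (V t' - V t)"
      using step[OF t] by (cases "haus N (F t) (F t')") auto
  qed
qed

section \<open>Metric chains and chain functions\<close>

text \<open>The constant comparing \<open>norm\<close> with \<open>N\<close> is absorbed into
  \<open>V\<close>, so all later increment bounds on chains and selections use the Euclidean
  norm.\<close>

lemma BV_metric_pairs_control:
  fixes N :: "'v::euclidean_space \<Rightarrow> real"
  assumes N: "is_norm N" and F: "F \<in> BV_compact_graph N a b" and "a < b"
  obtains V :: "real \<Rightarrow> real" where "mono V"
    "\<And>t t' y y'. a \<le> t \<Longrightarrow> t < t' \<Longrightarrow> t' \<le> b \<Longrightarrow> (y, y') \<in> metric_pairs N (F t) (F t') \<Longrightarrow>
      norm (y - y') \<le> V t' - V t"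
proof -
  obtain V where V: "mono V"
    "\<And>t t'. a \<le> t \<Longrightarrow> t < t' \<Longrightarrow> t' \<le> b \<Longrightarrow> haus N (F t) (F t') \<le> ereal (V t' - V t)"
    using BV_variation_function[OF assms] by metis
  obtain K where K: "K > 0" "\<And>v. norm v \<le> K * N v" using norm_le_is_norm[OF N] by metis
  show thesis
  proof (rule that[of "\<lambda>t. K * V t"])
    show "mono (\<lambda>t. K * V t)"
      using V(1) K(1) by (auto simp: mono_def)
    fix t t' y y'
    assume "a \<le> t" "t < t'" "t' \<le> b" "(y, y') \<in> metric_pairs N (F t) (F t')"
    then have "ereal (N (y - y')) \<le> ereal (V t' - V t)"
      by (meson V(2) metric_pairs_le_haus order_trans)
    then have "K * N (y - y') \<le> K * (V t' - V t)"
      using K(1) by simp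
    then show "norm (y - y') \<le> K * V t' - K * V t"
      using K(2)[of "y - y'"] by (simp add: right_diff_distrib)
  qed
qed

text \<open>The index hidden in \<open>chain_function\<close>, separated from the values so that it
  also locates the node below \<open>x\<close> and the weight at that node.\<close>

definition partition_index :: "nat \<Rightarrow> (nat \<Rightarrow> real) \<Rightarrow> real \<Rightarrow> nat" where
  "partition_index n \<xi> x = (if x = \<xi> n then n else THE i. i < n \<and> \<xi> i \<le> x \<and> x < \<xi> (Suc i))"

lemma chain_function_eq: "chain_function n \<xi> y x = y (partition_index n \<xi> x)"
  by (simp add: chain_function_def partition_index_def)

section \<open>Partitions and the location of points in them\<close>

lemma is_partition_less:
  assumes "is_partition a b n \<xi>" "i < j" "j \<le> n"
  shows "\<xi> i < \<xi> j"
  using assms(2,3)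
proof (induction j)
  case (Suc j)
  have "\<xi> j < \<xi> (Suc j)" using assms(1) Suc.prems by (auto simp: is_partition_def)
  then show ?case using Suc by (cases "i = j") auto
qed auto

lemma is_partition_le:
  assumes "is_partition a b n \<xi>" "i \<le> j" "j \<le> n"
  shows "\<xi> i \<le> \<xi> j"
  using is_partition_less[OF assms(1), of i j] assms by (cases "i = j") auto

lemma is_partition_mem:
  assumes "is_partition a b n \<xi>" "i \<le> n"
  shows "\<xi> i \<in> {a..b}"
  using is_partition_le[OF assms(1), of 0 i] is_partition_le[OF assms(1), of i n] assms
  by (auto simp: is_partition_def)

lemma is_partition_imp_less: "is_partition a b n \<xi> \<Longrightarrow> a < b"
  using is_partition_less[of a b n \<xi> 0 n] by (auto simp: is_partition_def)

lemma diff_le_mesh: "i < n \<Longrightarrow> \<xi> (Suc i) - \<xi> i \<le> mesh n \<xi>"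
  unfolding mesh_def by (intro Max_ge) auto

lemma partition_index_unique:
  assumes p: "is_partition a b n \<xi>" and i: "i < n" "\<xi> i \<le> x" "x < \<xi> (Suc i)"
  shows "partition_index n \<xi> x = i"
proof -
  have "x \<noteq> \<xi> n" using is_partition_le[OF p, of "Suc i" n] i by auto
  moreover have "(THE i. i < n \<and> \<xi> i \<le> x \<and> x < \<xi> (Suc i)) = i"
  proof (rule the_equality)
    fix j assume j: "j < n \<and> \<xi> j \<le> x \<and> x < \<xi> (Suc j)"
    have "\<not> i < j" using is_partition_le[OF p, of "Suc i" j] i j by auto
    moreover have "\<not> j < i" using is_partition_le[OF p, of "Suc j" i] i j by auto
    ultimately show "j = i" by simp
  qed (use i in auto)
  ultimately show ?thesis by (simp add: partition_index_def)
qed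

lemma partition_index:
  assumes p: "is_partition a b n \<xi>" and x: "x \<in> {a..b}"
  shows "partition_index n \<xi> x \<le> n" "\<xi> (partition_index n \<xi> x) \<le> x"
    "x - mesh n \<xi> \<le> \<xi> (partition_index n \<xi> x)"
    "partition_index n \<xi> x = n \<or> x < \<xi> (Suc (partition_index n \<xi> x))"
proof -
  have ends: "\<xi> 0 = a" "\<xi> n = b" "0 < n" using p by (auto simp: is_partition_def)
  have "partition_index n \<xi> x \<le> n \<and> \<xi> (partition_index n \<xi> x) \<le> x \<and>
    x - mesh n \<xi> \<le> \<xi> (partition_index n \<xi> x) \<and>
    (partition_index n \<xi> x = n \<or> x < \<xi> (Suc (partition_index n \<xi> x)))"
  proof (cases "x = b")
    case True
    have "\<xi> 0 < \<xi> (Suc 0)" using ends(3) p by (auto simp: is_partition_def)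
    then have "mesh n \<xi> \<ge> 0" using diff_le_mesh[of 0 n \<xi>] ends by linarith
    with True ends show ?thesis by (auto simp: partition_index_def)
  next
    case False
    define i where "i = Max {i. i \<le> n \<and> \<xi> i \<le> x}"
    have fin: "finite {i. i \<le> n \<and> \<xi> i \<le> x}" by simp
    have "i \<in> {i. i \<le> n \<and> \<xi> i \<le> x}"
      unfolding i_def using x ends by (intro Max_in fin) auto
    moreover from this have "i < n" using ends x False by (cases "i = n") auto
    moreover have "x < \<xi> (Suc i)"
    proof (rule ccontr)
      assume "\<not> x < \<xi> (Suc i)"
      then have "Suc i \<le> i" unfolding i_def using \<open>i < n\<close>
        by (intro Max_ge[OF fin]) (auto simp: i_def)
      then show False by simp
    qed
    ultimately show ?thesis
      using partition_index_unique[OF p, of i x] diff_le_mesh[of i n \<xi>] by auto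
  qed
  then show "partition_index n \<xi> x \<le> n" "\<xi> (partition_index n \<xi> x) \<le> x"
    "x - mesh n \<xi> \<le> \<xi> (partition_index n \<xi> x)"
    "partition_index n \<xi> x = n \<or> x < \<xi> (Suc (partition_index n \<xi> x))" by auto
qed

lemma partition_index_mono:
  assumes p: "is_partition a b n \<xi>" and x: "x \<in> {a..b}" "x' \<in> {a..b}" "x \<le> x'"
  shows "partition_index n \<xi> x \<le> partition_index n \<xi> x'"
proof (rule ccontr)
  assume *: "\<not> partition_index n \<xi> x \<le> partition_index n \<xi> x'"
  then have "\<xi> (Suc (partition_index n \<xi> x')) \<le> \<xi> (partition_index n \<xi> x)"
    using partition_index(1)[OF p x(1)] by (intro is_partition_le[OF p]) auto
  then show False
    using partition_index[OF p x(1)] partition_index(4)[OF p x(2)] x(3) * by auto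
qed

lemma partition_index_tendsto:
  assumes p: "\<And>k. is_partition a b (m k) (\<xi> k)" and "(\<lambda>k. mesh (m k) (\<xi> k)) \<longlonglongrightarrow> 0"
    and x: "x \<in> {a..b}"
  shows "(\<lambda>k. \<xi> k (partition_index (m k) (\<xi> k) x)) \<longlonglongrightarrow> x"
proof (rule tendsto_sandwich)
  show "(\<lambda>k. x - mesh (m k) (\<xi> k)) \<longlonglongrightarrow> x" using tendsto_diff[OF tendsto_const assms(2), of x] by simp
qed (use partition_index[OF p x] in auto)

lemma metric_chain_control:
  fixes N :: "'v::real_normed_vector \<Rightarrow> real"
  assumes p: "is_partition a b n \<xi>" and y: "y \<in> metric_chains N n (\<lambda>i. F (\<xi> i))"
    and V: "\<And>t t' y y'. a \<le> t \<Longrightarrow> t < t' \<Longrightarrow> t' \<le> b \<Longrightarrow> (y, y') \<in> metric_pairs N (F t) (F t') \<Longrightarrow>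
      norm (y - y') \<le> V t' - V t"
    and ij: "i \<le> j" "j \<le> n"
  shows "norm (y i - y j) \<le> V (\<xi> j) - V (\<xi> i)"
  using ij
proof (induction j rule: dec_induct)
  case (step j)
  have "norm (y j - y (Suc j)) \<le> V (\<xi> (Suc j)) - V (\<xi> j)"
    using y is_partition_mem[OF p, of j] is_partition_mem[OF p, of "Suc j"]
      is_partition_less[OF p, of j "Suc j"] step.prems
    by (intro V) (auto simp: metric_chains_def)
  moreover have "norm (y i - y (Suc j)) \<le> norm (y i - y j) + norm (y j - y (Suc j))"
    using norm_triangle_ineq[of "y i - y j" "y j - y (Suc j)"] by simp
  ultimately show ?case using step by auto
qed auto

text \<open>The increment is that of \<open>V\<close> between two nodes. The node of
  \<open>t'\<close> is at most \<open>t'\<close>, but the node of \<open>t\<close> may precede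
  \<open>t\<close> by up to one mesh width, whence the lag.\<close>

lemma chain_function_control:
  fixes N :: "'v::real_normed_vector \<Rightarrow> real"
  assumes p: "is_partition a b n \<xi>" and y: "y \<in> metric_chains N n (\<lambda>i. F (\<xi> i))"
    and "mono V"
    and V: "\<And>t t' y y'. a \<le> t \<Longrightarrow> t < t' \<Longrightarrow> t' \<le> b \<Longrightarrow> (y, y') \<in> metric_pairs N (F t) (F t') \<Longrightarrow>
      norm (y - y') \<le> V t' - V t"
    and t: "a \<le> t" "t \<le> t'" "t' \<le> b"
  shows "norm (chain_function n \<xi> y t - chain_function n \<xi> y t') \<le> V t' - V (t - mesh n \<xi>)"
proof -
  let ?i = "partition_index n \<xi> t" and ?j = "partition_index n \<xi> t'"
  have "norm (y ?i - y ?j) \<le> V (\<xi> ?j) - V (\<xi> ?i)"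
    using partition_index_mono[OF p, of t t'] partition_index(1)[OF p, of t'] t
    by (intro metric_chain_control[OF p y V]) auto
  also have "\<dots> \<le> V t' - V (t - mesh n \<xi>)"
    using partition_index[OF p, of t] partition_index[OF p, of t'] t
    by (intro diff_mono monoD[OF \<open>mono V\<close>]) auto
  finally show ?thesis by (simp add: chain_function_eq)
qed

text \<open>A nearest point always continues a chain. Weighted sums use chains without the last
  node, whereas chain functions need a value there; this lemma bridges the gap.\<close>

lemma metric_chains_extend:
  fixes N :: "'v::euclidean_space \<Rightarrow> real"
  assumes N: "is_norm N" and y: "y \<in> metric_chains N n A" and A: "compact (A (Suc n))" "A (Suc n) \<noteq> {}"
  obtains z where "y(Suc n := z) \<in> metric_chains N (Suc n) A"
proof -
  obtain z where z: "z \<in> A (Suc n)" "dist_to N (y n) (A (Suc n)) = ereal (N (y n - z))"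
    using dist_to_attained[OF N A] by blast
  have "(y n, z) \<in> metric_pairs N (A n) (A (Suc n))"
    using y z by (auto simp: metric_pairs_def metric_chains_def)
  then have "y(Suc n := z) \<in> metric_chains N (Suc n) A"
    using y z(1) by (auto simp: metric_chains_def less_Suc_eq le_Suc_eq)
  then show thesis by (rule that)
qed

lemma metric_chains_nonempty:
  fixes N :: "'v::euclidean_space \<Rightarrow> real"
  assumes N: "is_norm N" and A: "\<And>i. i \<le> n \<Longrightarrow> compact (A i) \<and> A i \<noteq> {}"
  shows "metric_chains N n A \<noteq> {}"
  using A
proof (induction n)
  case 0
  then obtain y where "y \<in> A 0" by blast
  then have "(\<lambda>_. y) \<in> metric_chains N 0 A" by (simp add: metric_chains_def)
  then show ?case by blast
next
  case (Suc n)
  then obtain y where "y \<in> metric_chains N n A" by fastforce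
  then show ?case using metric_chains_extend[OF N, of y n A] Suc.prems[of "Suc n"] by blast
qed

text \<open>Turns Riemann sums into integrals of step functions, to which dominated convergence
  applies. The value \<open>y n\<close> sits on a single point and does not contribute.\<close>

lemma has_integral_chain_function:
  fixes y :: "nat \<Rightarrow> 'v::euclidean_space"
  assumes p: "is_partition a b n \<xi>"
  shows "(chain_function n \<xi> y has_integral (\<Sum>i<n. (\<xi> (Suc i) - \<xi> i) *\<^sub>R y i)) {a..b}"
proof -
  have "(chain_function n \<xi> y has_integral (\<Sum>i<m. (\<xi> (Suc i) - \<xi> i) *\<^sub>R y i)) {\<xi> 0..\<xi> m}"
    if "m \<le> n" for m
    using that
  proof (induction m)
    case 0
    show ?case by (simp add: has_integral_refl)
  next
    case (Suc m)
    have le: "\<xi> m \<le> \<xi> (Suc m)" using is_partition_le[OF p] Suc.prems by auto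
    have "((\<lambda>_. y m) has_integral (\<xi> (Suc m) - \<xi> m) *\<^sub>R y m) {\<xi> m..\<xi> (Suc m)}"
      using has_integral_const_real[of "y m" "\<xi> m" "\<xi> (Suc m)"] le by simp
    then have "(chain_function n \<xi> y has_integral (\<xi> (Suc m) - \<xi> m) *\<^sub>R y m) {\<xi> m..\<xi> (Suc m)}"
    proof (rule has_integral_spike_finite[of "{\<xi> (Suc m)}", rotated 2])
      fix x assume "x \<in> {\<xi> m..\<xi> (Suc m)} - {\<xi> (Suc m)}"
      then show "chain_function n \<xi> y x = y m"
        using partition_index_unique[OF p, of m x] Suc.prems by (auto simp: chain_function_eq)
    qed simp
    then show ?case
      using has_integral_combine[of "\<xi> 0" "\<xi> m" "\<xi> (Suc m)"] Suc le is_partition_le[OF p, of 0 m]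
      by simp
  qed
  from this[of n] show ?thesis using p by (auto simp: is_partition_def)
qed

section \<open>Metric selections and the weighted metric integral\<close>

text \<open>Helly's theorem for functions controlled by a fixed \<open>V\<close> up to a vanishing
  lag \<open>e k\<close>. A diagonal subsequence converges on a countable set; at any other point
  \<open>V\<close> is continuous, and there the lag is harmless.\<close>

lemma Helly_selection_vector:
  fixes c :: "nat \<Rightarrow> real \<Rightarrow> 'v::euclidean_space"
  assumes "mono V" and e: "e \<longlonglongrightarrow> 0" and M: "\<And>k t. t \<in> {a..b} \<Longrightarrow> norm (c k t) \<le> M"
    and ctrl: "\<And>k t t'. a \<le> t \<Longrightarrow> t \<le> t' \<Longrightarrow> t' \<le> b \<Longrightarrow> norm (c k t - c k t') \<le> V t' - V (t - e k)"
  obtains r s where "strict_mono r" "\<And>t. t \<in> {a..b} \<Longrightarrow> (\<lambda>k. c (r k) t) \<longlonglongrightarrow> s t"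
proof -
  \<comment> \<open>Rationals supply comparison points to the right of \<open>t\<close>. The end
    \<open>b\<close> has no such points in the interval, and discontinuities of \<open>V\<close>
    admit no comparison, so both are included.\<close>
  define D where "D = ({t. \<not> isCont V t} \<union> \<rat> \<union> {b}) \<inter> {a..b}"
  have "countable D"
    unfolding D_def using mono_ctble_discont[OF \<open>mono V\<close>] countable_rat by auto
  then obtain r where r: "strict_mono r" "\<And>t. t \<in> D \<Longrightarrow> \<exists>l. (\<lambda>k. c (r k) t) \<longlonglongrightarrow> l"
    using function_convergent_subsequence[of D c M] M unfolding D_def by auto
  have "convergent (\<lambda>k. c (r k) t)" if t: "t \<in> {a..b}" for t
  proof (cases "t \<in> D")
    case False
    with t have t': "isCont V t" "t < b" by (auto simp: D_def)
    have "Cauchy (\<lambda>k. c (r k) t)"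
    proof (rule metric_CauchyI)
      fix \<epsilon> :: real assume "0 < \<epsilon>"
      then obtain \<eta> where \<eta>: "\<eta> > 0" "\<And>u. \<bar>u - t\<bar> < \<eta> \<Longrightarrow> \<bar>V u - V t\<bar> < \<epsilon> / 8"
        using t'(1)[unfolded continuous_at_eps_delta, rule_format, of "\<epsilon> / 8"]
        by (auto simp: dist_real_def)
      obtain q where q: "q \<in> \<rat>" "t < q" "q < min b (t + \<eta>)"
        using Rats_dense_in_real[of t "min b (t + \<eta>)"] t'(2) \<eta>(1) by auto
      then have "q \<in> D" using t by (auto simp: D_def)
      then have "Cauchy (\<lambda>k. c (r k) q)" using r(2) LIMSEQ_imp_Cauchy by blast
      then obtain n1 where n1: "\<And>k l. k \<ge> n1 \<Longrightarrow> l \<ge> n1 \<Longrightarrow> dist (c (r k) q) (c (r l) q) < \<epsilon> / 4"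
        using \<open>0 < \<epsilon>\<close> unfolding Cauchy_def by (meson divide_pos_pos zero_less_numeral)
      have "(\<lambda>k. e (r k)) \<longlonglongrightarrow> 0" using LIMSEQ_subseq_LIMSEQ[OF e r(1)] by (simp add: o_def)
      then obtain n2 where n2: "\<And>k. k \<ge> n2 \<Longrightarrow> \<bar>e (r k)\<bar> < \<eta>"
        using LIMSEQ_D[of "\<lambda>k. e (r k)" 0 \<eta>] \<eta>(1) by auto
      \<comment> \<open>Both arguments of \<open>V\<close> lie within \<eta> of the continuity point
        \<open>t\<close>, one through the choice of \<open>q\<close> and the other through the small
        lag. The bound holds for all late \<open>k\<close> simultaneously.\<close>
      have near: "dist (c (r k) t) (c (r k) q) < \<epsilon> / 4" if "k \<ge> n2" for k
      proof -
        have "norm (c (r k) t - c (r k) q) \<le> V q - V (t - e (r k))"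
          using q t by (intro ctrl) auto
        moreover have "\<bar>V q - V t\<bar> < \<epsilon> / 8" "\<bar>V (t - e (r k)) - V t\<bar> < \<epsilon> / 8"
          using q(2,3) n2[OF that] by (intro \<eta>(2); simp)+
        ultimately show ?thesis unfolding dist_norm by linarith
      qed
      show "\<exists>n. \<forall>k\<ge>n. \<forall>l\<ge>n. dist (c (r k) t) (c (r l) t) < \<epsilon>"
      proof (intro exI allI impI)
        fix k l assume "k \<ge> max n1 n2" "l \<ge> max n1 n2"
        then have "dist (c (r k) t) (c (r k) q) < \<epsilon> / 4" "dist (c (r l) t) (c (r l) q) < \<epsilon> / 4"
          "dist (c (r k) q) (c (r l) q) < \<epsilon> / 4" using near n1 by auto
        moreover have "dist (c (r k) t) (c (r l) t) \<le> dist (c (r k) t) (c (r k) q) +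
            (dist (c (r k) q) (c (r l) q) + dist (c (r l) t) (c (r l) q))"
          using dist_triangle[of "c (r k) t" "c (r l) t" "c (r k) q"]
            dist_triangle[of "c (r k) q" "c (r l) t" "c (r l) q"]
          by (simp add: dist_commute)
        ultimately show "dist (c (r k) t) (c (r l) t) < \<epsilon>" using \<open>0 < \<epsilon>\<close> by linarith
      qed
    qed
    then show ?thesis by (rule Cauchy_convergent)
  qed (use r(2) in \<open>auto simp: convergent_def\<close>)
  then show thesis
    using that[OF r(1), of "\<lambda>t. lim (\<lambda>k. c (r k) t)"] by (auto simp: convergent_LIMSEQ_iff)
qed

lemma BV_compact_graph_bounded:
  assumes "F \<in> BV_compact_graph N a b"
  obtains M where "\<And>t y. t \<in> {a..b} \<Longrightarrow> y \<in> F t \<Longrightarrow> norm y \<le> M"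
proof -
  have "compact (snd ` {(x, y). x \<in> {a..b} \<and> y \<in> F x})"
    using assms by (intro compact_continuous_image continuous_intros) (auto simp: BV_compact_graph_def)
  then have "bounded (snd ` {(x, y). x \<in> {a..b} \<and> y \<in> F x})"
    by (rule compact_imp_bounded)
  then obtain M where "\<forall>y\<in>snd ` {(x, y). x \<in> {a..b} \<and> y \<in> F x}. norm y \<le> M"
    unfolding bounded_iff by blast
  then show thesis by (intro that[of M]) force
qed

text \<open>Compactness of the graph is what puts \<open>s x\<close> into \<open>F x\<close>: the
  pairs of node and chain value lie in the graph, and the nodes tend to \<open>x\<close>.\<close>

lemma metric_selections_limit:
  assumes F: "F \<in> BV_compact_graph N a b"
    and p: "\<And>k. is_partition a b (m k) (\<xi> k)"
    and y: "\<And>k. y k \<in> metric_chains N (m k) (\<lambda>i. F (\<xi> k i))"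
    and mesh: "(\<lambda>k. mesh (m k) (\<xi> k)) \<longlonglongrightarrow> 0"
    and s: "\<And>x. x \<in> {a..b} \<Longrightarrow> (\<lambda>k. chain_function (m k) (\<xi> k) (y k) x) \<longlonglongrightarrow> s x"
  shows "s \<in> metric_selections N a b F"
proof -
  have "s x \<in> F x" if x: "x \<in> {a..b}" for x
  proof -
    let ?i = "\<lambda>k. partition_index (m k) (\<xi> k) x" and ?G = "{(x, y). x \<in> {a..b} \<and> y \<in> F x}"
    have "closed ?G" using F by (auto simp: BV_compact_graph_def intro: compact_imp_closed)
    moreover have "(\<xi> k (?i k), y k (?i k)) \<in> ?G" for k
      using partition_index(1)[OF p x, of k] is_partition_mem[OF p, of "?i k" k] y[of k]
      by (auto simp: metric_chains_def)
    moreover have "(\<lambda>k. (\<xi> k (?i k), y k (?i k))) \<longlonglongrightarrow> (x, s x)"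
      using partition_index_tendsto[OF p mesh x] s[OF x]
      by (intro tendsto_Pair) (auto simp: chain_function_eq)
    ultimately have "(x, s x) \<in> ?G" by (rule closed_sequentially)
    then show ?thesis by simp
  qed
  then show ?thesis using p y mesh s unfolding metric_selections_def by blast
qed

lemma metric_selections_subsequence:
  fixes N :: "'v::euclidean_space \<Rightarrow> real"
  assumes N: "is_norm N" and F: "F \<in> BV_compact_graph N a b"
    and p: "\<And>k. is_partition a b (m k) (\<xi> k)"
    and y: "\<And>k. y k \<in> metric_chains N (m k) (\<lambda>i. F (\<xi> k i))"
    and mesh: "(\<lambda>k. mesh (m k) (\<xi> k)) \<longlonglongrightarrow> 0"
  obtains r s where "strict_mono r" "s \<in> metric_selections N a b F"
    "\<And>x. x \<in> {a..b} \<Longrightarrow>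
      (\<lambda>k. chain_function (m (r k)) (\<xi> (r k)) (y (r k)) x) \<longlonglongrightarrow> s x"
proof -
  have "a < b" by (rule is_partition_imp_less[OF p])
  obtain V where V: "mono V"
    "\<And>t t' y y'. a \<le> t \<Longrightarrow> t < t' \<Longrightarrow> t' \<le> b \<Longrightarrow> (y, y') \<in> metric_pairs N (F t) (F t') \<Longrightarrow>
      norm (y - y') \<le> V t' - V t"
    using BV_metric_pairs_control[OF N F \<open>a < b\<close>] by blast
  obtain M where M: "\<And>t y. t \<in> {a..b} \<Longrightarrow> y \<in> F t \<Longrightarrow> norm y \<le> M"
    using BV_compact_graph_bounded[OF F] by blast
  have bdd: "norm (chain_function (m k) (\<xi> k) (y k) t) \<le> M" if "t \<in> {a..b}" for k t
    using y[of k] partition_index(1)[OF p that, of k]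
    by (auto simp: chain_function_eq metric_chains_def intro!: M[OF is_partition_mem[OF p]])
  have "norm (chain_function (m k) (\<xi> k) (y k) t - chain_function (m k) (\<xi> k) (y k) t')
      \<le> V t' - V (t - mesh (m k) (\<xi> k))" if "a \<le> t" "t \<le> t'" "t' \<le> b" for k t t'
    using chain_function_control[OF p y V that] by blast
  then obtain r s where rs: "strict_mono r" "\<And>x. x \<in> {a..b} \<Longrightarrow>
      (\<lambda>k. chain_function (m (r k)) (\<xi> (r k)) (y (r k)) x) \<longlonglongrightarrow> s x"
    using Helly_selection_vector[OF V(1) mesh, of a b "\<lambda>k. chain_function (m k) (\<xi> k) (y k)" M] bdd
    by blast
  have "s \<in> metric_selections N a b F"
    using rs(2) LIMSEQ_subseq_LIMSEQ[OF mesh rs(1)]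
    by (intro metric_selections_limit[OF F, of "m \<circ> r" "\<xi> \<circ> r" "y \<circ> r"]) (auto simp: p y o_def)
  with rs show thesis using that by blast
qed

text \<open>Excludes the degenerate value of \<open>haus\<close> on empty sets, which is
  -\<infinity>. Chains over equidistant partitions have a subsequence converging to a
  selection.\<close>

lemma metric_selections_nonempty:
  fixes N :: "'v::euclidean_space \<Rightarrow> real"
  assumes N: "is_norm N" and F: "F \<in> BV_compact_graph N a b" and "a < b"
  shows "metric_selections N a b F \<noteq> {}"
proof -
  define \<xi> where "\<xi> k i = a + real i * ((b - a) / real (Suc k))" for k i
  have p: "is_partition a b (Suc k) (\<xi> k)" for k
  proof -
    have "\<xi> k i < \<xi> k (Suc i)" for i
      using \<open>a < b\<close> unfolding \<xi>_def by (intro add_strict_left_mono mult_strict_right_mono) auto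
    then show ?thesis by (auto simp: is_partition_def \<xi>_def)
  qed
  have "\<xi> k (Suc i) - \<xi> k i = (b - a) / real (Suc k)" for k i
    by (simp add: \<xi>_def algebra_simps flip: add_divide_distrib)
  then have "mesh (Suc k) (\<xi> k) = (b - a) * inverse (real (Suc k))" for k
    by (simp add: mesh_def image_constant_conv lessThan_empty_iff divide_inverse)
  then have mesh: "(\<lambda>k. mesh (Suc k) (\<xi> k)) \<longlonglongrightarrow> 0"
    using tendsto_mult_right_zero[OF LIMSEQ_inverse_real_of_nat, of "b - a"] by simp
  have "metric_chains N (Suc k) (\<lambda>i. F (\<xi> k i)) \<noteq> {}" for k
    using F is_partition_mem[OF p] by (intro metric_chains_nonempty[OF N]) (auto simp: BV_compact_graph_def)
  then have "(SOME y. y \<in> metric_chains N (Suc k) (\<lambda>i. F (\<xi> k i)))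
      \<in> metric_chains N (Suc k) (\<lambda>i. F (\<xi> k i))" for k
    by (simp add: some_in_eq)
  then show ?thesis
    by (rule metric_selections_subsequence[OF N F p _ mesh]) blast
qed

text \<open>Freezing the weight at the left nodes makes the summand values of a step function
  \<open>g k\<close>. Continuity of \<open>w\<close> gives the pointwise limit, and
  \<open>B * M\<close> dominates.\<close>

lemma weighted_sums_tendsto_integral:
  fixes s :: "real \<Rightarrow> 'v::euclidean_space"
  assumes p: "\<And>k. is_partition a b (m k) (\<xi> k)" and M: "\<And>k i. i \<le> m k \<Longrightarrow> norm (y k i) \<le> M"
    and mesh: "(\<lambda>k. mesh (m k) (\<xi> k)) \<longlonglongrightarrow> 0"
    and s: "\<And>x. x \<in> {a..b} \<Longrightarrow> (\<lambda>k. chain_function (m k) (\<xi> k) (y k) x) \<longlonglongrightarrow> s x"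
    and w: "continuous_on {a..b} w"
  shows "(\<lambda>k. \<Sum>i<m k. ((\<xi> k (Suc i) - \<xi> k i) * w (\<xi> k i)) *\<^sub>R y k i)
    \<longlonglongrightarrow> integral {a..b} (\<lambda>t. w t *\<^sub>R s t)"
proof -
  define g where "g k = chain_function (m k) (\<xi> k) (\<lambda>i. w (\<xi> k i) *\<^sub>R y k i)" for k
  have g: "(g k has_integral (\<Sum>i<m k. ((\<xi> k (Suc i) - \<xi> k i) * w (\<xi> k i)) *\<^sub>R y k i)) {a..b}" for k
    using has_integral_chain_function[OF p, of k "\<lambda>i. w (\<xi> k i) *\<^sub>R y k i"] by (simp add: g_def)
  have "bounded (w ` {a..b})"
    by (intro compact_imp_bounded compact_continuous_image w) simp
  then obtain B where B: "\<And>t. t \<in> {a..b} \<Longrightarrow> \<bar>w t\<bar> \<le> B"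
    unfolding bounded_iff by (metis imageI real_norm_def)
  have "(\<lambda>k. integral {a..b} (g k)) \<longlonglongrightarrow> integral {a..b} (\<lambda>t. w t *\<^sub>R s t)"
  proof (rule dominated_convergence(2)[of _ _ "\<lambda>_. B * M"])
    fix k t assume t: "t \<in> {a..b}"
    let ?i = "partition_index (m k) (\<xi> k) t"
    have "\<bar>w (\<xi> k ?i)\<bar> \<le> B" "norm (y k ?i) \<le> M"
      using partition_index(1)[OF p t, of k] is_partition_mem[OF p] by (auto intro: B M)
    then show "norm (g k t) \<le> B * M"
      unfolding g_def chain_function_eq norm_scaleR by (intro mult_mono) auto
  next
    fix t assume t: "t \<in> {a..b}"
    have "(\<lambda>k. w (\<xi> k (partition_index (m k) (\<xi> k) t))) \<longlonglongrightarrow> w t"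
      by (intro continuous_on_tendsto_compose[OF w partition_index_tendsto[OF p mesh t] t]
          always_eventually allI is_partition_mem[OF p] partition_index(1)[OF p t])
    then show "(\<lambda>k. g k t) \<longlonglongrightarrow> w t *\<^sub>R s t"
      using tendsto_scaleR[OF _ s[OF t]] by (simp add: g_def chain_function_eq)
  qed (use g in auto)
  then show ?thesis using integral_unique[OF g] by simp
qed

lemma weighted_metric_integral_eq:
  fixes N :: "'v::euclidean_space \<Rightarrow> real"
  assumes N: "is_norm N" and F: "F \<in> BV_compact_graph N a b" and w: "continuous_on {a..b} w"
  shows "weighted_metric_integral N w a b F =
    (\<lambda>s. integral {a..b} (\<lambda>t. w t *\<^sub>R s t)) ` metric_selections N a b F"
proof (intro set_eqI iffI)
  obtain M where M: "\<And>t y. t \<in> {a..b} \<Longrightarrow> y \<in> F t \<Longrightarrow> norm y \<le> M"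
    using BV_compact_graph_bounded[OF F] by blast
  have bdd: "norm (y i) \<le> M" if "is_partition a b n \<xi>" "y \<in> metric_chains N n (\<lambda>i. F (\<xi> i))" "i \<le> n"
    for n \<xi> and i :: nat and y
    using that by (auto simp: metric_chains_def intro!: M[OF is_partition_mem])
  fix z
  {
    assume "z \<in> weighted_metric_integral N w a b F"
    then obtain m \<xi> u where p: "\<And>k. is_partition a b (m k) (\<xi> k)"
      and u: "\<And>k. u k \<in> weighted_metric_sums N w (m k) (\<xi> k) F"
      and mesh: "(\<lambda>k. mesh (m k) (\<xi> k)) \<longlonglongrightarrow> 0" and z: "u \<longlonglongrightarrow> z"
      unfolding weighted_metric_integral_def by blast
    \<comment> \<open>Each sum is realised by a full chain. Changing \<open>y\<close> at index
      \<open>m k\<close> does not affect it, since the sum stops before that index.\<close>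
    have "\<exists>y\<in>metric_chains N (m k) (\<lambda>i. F (\<xi> k i)).
        u k = (\<Sum>i<m k. ((\<xi> k (Suc i) - \<xi> k i) * w (\<xi> k i)) *\<^sub>R y i)" for k
    proof -
      obtain y where y: "y \<in> metric_chains N (m k - 1) (\<lambda>i. F (\<xi> k i))"
        "u k = (\<Sum>i<m k. ((\<xi> k (Suc i) - \<xi> k i) * w (\<xi> k i)) *\<^sub>R y i)"
        using u[of k] unfolding weighted_metric_sums_def by blast
      have m: "m k = Suc (m k - 1)" using p[of k] by (simp add: is_partition_def)
      have "compact (F (\<xi> k (Suc (m k - 1))))" "F (\<xi> k (Suc (m k - 1))) \<noteq> {}"
        using F is_partition_mem[OF p, of "Suc (m k - 1)" k] m by (auto simp: BV_compact_graph_def)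
      then obtain x where "y(Suc (m k - 1) := x) \<in> metric_chains N (Suc (m k - 1)) (\<lambda>i. F (\<xi> k i))"
        by (rule metric_chains_extend[OF N y(1)])
      then show ?thesis
        using y(2) m by (intro bexI[of _ "y(m k := x)"]) (auto intro!: sum.cong)
    qed
    then obtain y where y: "\<And>k. y k \<in> metric_chains N (m k) (\<lambda>i. F (\<xi> k i))"
        "\<And>k. u k = (\<Sum>i<m k. ((\<xi> k (Suc i) - \<xi> k i) * w (\<xi> k i)) *\<^sub>R y k i)"
      by metis
    obtain r s where r: "strict_mono r" and s: "s \<in> metric_selections N a b F"
      "\<And>x. x \<in> {a..b} \<Longrightarrow>
        (\<lambda>k. chain_function (m (r k)) (\<xi> (r k)) (y (r k)) x) \<longlonglongrightarrow> s x"
      using metric_selections_subsequence[OF N F p y(1) mesh] by blast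
    \<comment> \<open>The whole sequence \<open>u\<close> already converges to \<open>z\<close>, so
      a subsequence is enough to identify \<open>z\<close>.\<close>
    have "(\<lambda>k. u (r k)) \<longlonglongrightarrow> integral {a..b} (\<lambda>t. w t *\<^sub>R s t)"
      unfolding y(2) using bdd[OF p y(1)] LIMSEQ_subseq_LIMSEQ[OF mesh r] s(2)
      by (intro weighted_sums_tendsto_integral[OF p _ _ _ w, where M = M]) (auto simp: o_def)
    then have "z = integral {a..b} (\<lambda>t. w t *\<^sub>R s t)"
      using LIMSEQ_subseq_LIMSEQ[OF z r] LIMSEQ_unique by (auto simp: o_def)
    then show "z \<in> (\<lambda>s. integral {a..b} (\<lambda>t. w t *\<^sub>R s t)) ` metric_selections N a b F"
      using s(1) by blast
  next
    assume "z \<in> (\<lambda>s. integral {a..b} (\<lambda>t. w t *\<^sub>R s t)) ` metric_selections N a b F"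
    then obtain s m \<xi> y where z: "z = integral {a..b} (\<lambda>t. w t *\<^sub>R s t)"
      and p: "\<And>k. is_partition a b (m k) (\<xi> k)"
      and y: "\<And>k. y k \<in> metric_chains N (m k) (\<lambda>i. F (\<xi> k i))"
      and mesh: "(\<lambda>k. mesh (m k) (\<xi> k)) \<longlonglongrightarrow> 0"
      and s: "\<And>x. x \<in> {a..b} \<Longrightarrow> (\<lambda>k. chain_function (m k) (\<xi> k) (y k) x) \<longlonglongrightarrow> s x"
      unfolding metric_selections_def by blast
    have "y k \<in> metric_chains N (m k - 1) (\<lambda>i. F (\<xi> k i))" for k
      using y[of k] by (auto simp: metric_chains_def)
    then have "(\<Sum>i<m k. ((\<xi> k (Suc i) - \<xi> k i) * w (\<xi> k i)) *\<^sub>R y k i)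
        \<in> weighted_metric_sums N w (m k) (\<xi> k) F" for k
      unfolding weighted_metric_sums_def by blast
    moreover have "(\<lambda>k. \<Sum>i<m k. ((\<xi> k (Suc i) - \<xi> k i) * w (\<xi> k i)) *\<^sub>R y k i) \<longlonglongrightarrow> z"
      unfolding z by (rule weighted_sums_tendsto_integral[OF p bdd[OF p y] mesh s w])
    ultimately show "z \<in> weighted_metric_integral N w a b F"
      using p mesh unfolding weighted_metric_integral_def mem_Collect_eq
      by (intro exI[of _ m] exI[of _ \<xi>] exI conjI allI)
  }
qed

lemma metric_selections_control:
  fixes N :: "'v::euclidean_space \<Rightarrow> real"
  assumes N: "is_norm N" and F: "F \<in> BV_compact_graph N a b" and "a < b"
  obtains v :: "real \<Rightarrow> real" where "mono v"
    "\<And>s t t'. s \<in> metric_selections N a b F \<Longrightarrow> a \<le> t \<Longrightarrow> t < t' \<Longrightarrow> t' \<le> b \<Longrightarrow>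
      norm (s t - s t') \<le> v t' - v t"
proof -
  obtain V where V: "mono V"
    "\<And>t t' y y'. a \<le> t \<Longrightarrow> t < t' \<Longrightarrow> t' \<le> b \<Longrightarrow> (y, y') \<in> metric_pairs N (F t) (F t') \<Longrightarrow>
      norm (y - y') \<le> V t' - V t"
    using BV_metric_pairs_control[OF N F \<open>a < b\<close>] by blast
  \<comment> \<open>A selection is only controlled by \<open>V t' - V (t-)\<close>, which is not additive; it is dominated by
    the increment of \<open>V t + V (t-)\<close>.\<close>
  define L where "L t = (SUP u\<in>{..<t}. V u)" for t
  have bdd: "bdd_above (V ` {..<t})" for t
    using monoD[OF V(1)] by (intro bdd_aboveI2[of _ _ "V t"]) auto
  have L_ge: "V u \<le> L t" if "u < t" for u t
    unfolding L_def using that by (intro cSUP_upper bdd) auto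
  have L_le: "L t \<le> B" if "\<And>u. u < t \<Longrightarrow> V u \<le> B" for t B
    unfolding L_def using that lt_ex by (intro cSUP_least) auto
  show thesis
  proof (rule that[of "\<lambda>t. V t + L t"])
    show "mono (\<lambda>t. V t + L t)"
      by (intro monoI add_mono monoD[OF V(1)] L_le L_ge) auto
    fix s t t' assume s: "s \<in> metric_selections N a b F" and t: "a \<le> t" "t < t'" "t' \<le> b"
    from s obtain m \<xi> y where p: "\<And>k. is_partition a b (m k) (\<xi> k)"
      and y: "\<And>k. y k \<in> metric_chains N (m k) (\<lambda>i. F (\<xi> k i))"
      and mesh: "(\<lambda>k. mesh (m k) (\<xi> k)) \<longlonglongrightarrow> 0"
      and lim: "\<And>x. x \<in> {a..b} \<Longrightarrow> (\<lambda>k. chain_function (m k) (\<xi> k) (y k) x) \<longlonglongrightarrow> s x"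
      unfolding metric_selections_def by blast
    let ?c = "\<lambda>k. chain_function (m k) (\<xi> k) (y k)"
    \<comment> \<open>Once the mesh is below \<open>t - u\<close>, the lagged argument is to the
      right of \<open>u\<close>. The supremum over all such \<open>u\<close> then replaces
      \<open>V u\<close> by \<open>L t\<close>.\<close>
    have "V u \<le> V t' - norm (s t - s t')" if "u < t" for u
    proof -
      have "norm (s t - s t') \<le> V t' - V u"
      proof (rule tendsto_upperbound)
        show "(\<lambda>k. norm (?c k t - ?c k t')) \<longlonglongrightarrow> norm (s t - s t')"
          using t by (intro tendsto_norm tendsto_diff lim) auto
        have "\<forall>\<^sub>F k in sequentially. mesh (m k) (\<xi> k) < t - u"
          using mesh that by (intro order_tendstoD) auto
        then show "\<forall>\<^sub>F k in sequentially. norm (?c k t - ?c k t') \<le> V t' - V u"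
        proof eventually_elim
          case (elim k)
          have "norm (?c k t - ?c k t') \<le> V t' - V (t - mesh (m k) (\<xi> k))"
            using t by (intro chain_function_control[OF p y V]) auto
          also have "\<dots> \<le> V t' - V u" using elim by (intro diff_left_mono monoD[OF V(1)]) auto
          finally show ?case .
        qed
      qed simp
      then show ?thesis by simp
    qed
    then have "L t \<le> V t' - norm (s t - s t')" by (rule L_le)
    \<comment> \<open>The bound so far is \<open>V t' - L t\<close>; adding
      \<open>L t' - V t\<close>, which is nonnegative since \<open>t < t'\<close>, makes it an
      increment.\<close>
    then show "norm (s t - s t') \<le> (V t' + L t') - (V t + L t)"
      using L_ge[OF t(2)] by simp
  qed
qed

section \<open>Convergence of the metric Fourier series\<close>

text \<open>Both sides of \<open>x\<close> are moved to the right of 0. On the left the reflected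
  dominating function is \<open>- v (x - u)\<close>, which increases in \<open>u\<close>. Each side
  contributes pi/2 times its one-sided limit, since the kernel is even.\<close>

lemma Dirichlet_Jordan_uniform:
  fixes v :: "real \<Rightarrow> real"
  assumes "mono v" and x: "x \<in> {- pi<..<pi}" and "0 < \<epsilon>"
  shows "\<forall>\<^sub>F n in sequentially. \<forall>f.
    (\<forall>t\<in>{-pi..pi}. \<bar>f t\<bar> \<le> M) \<and>
    (\<forall>t t'. - pi \<le> t \<and> t < t' \<and> t' \<le> pi \<longrightarrow> \<bar>f t - f t'\<bar> \<le> v t' - v t) \<longrightarrow>
    (\<exists>I p q. ((\<lambda>t. Dirichlet_kernel n (x - t) * f t) has_integral I) {-pi..pi} \<and>
      (f \<longlongrightarrow> p) (at_right x) \<and> (f \<longlongrightarrow> q) (at_left x) \<and> \<bar>I - pi / 2 * (p + q)\<bar> \<le> \<epsilon>)"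
proof -
  define B where "B = max \<bar>v (- pi)\<bar> \<bar>v pi\<bar>"
  have B: "\<bar>v t\<bar> \<le> B" if "t \<in> {- pi..pi}" for t
    using monoD[OF \<open>mono v\<close>, of "- pi" t] monoD[OF \<open>mono v\<close>, of t pi] that unfolding B_def by auto
  have right: "\<forall>\<^sub>F n in sequentially. \<forall>f. (\<forall>u\<in>{0<..pi - x}. \<bar>f u\<bar> \<le> M) \<and>
      (\<forall>t u. 0 < t \<and> t < u \<and> u \<le> pi - x \<longrightarrow> \<bar>f t - f u\<bar> \<le> v (x + u) - v (x + t)) \<longrightarrow>
      (\<exists>I l. ((\<lambda>u. f u * Dirichlet_kernel n u) has_integral I) {0..pi - x} \<and>
        (f \<longlongrightarrow> l) (at_right 0) \<and> \<bar>I - pi / 2 * l\<bar> \<le> \<epsilon> / 2)"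
    using x \<open>0 < \<epsilon>\<close> monoD[OF \<open>mono v\<close>]
    by (intro Dirichlet_integral_uniform[where B = B] B mono_onI) auto
  have left: "\<forall>\<^sub>F n in sequentially. \<forall>f. (\<forall>u\<in>{0<..x + pi}. \<bar>f u\<bar> \<le> M) \<and>
      (\<forall>t u. 0 < t \<and> t < u \<and> u \<le> x + pi \<longrightarrow> \<bar>f t - f u\<bar> \<le> - v (x - u) - - v (x - t)) \<longrightarrow>
      (\<exists>I l. ((\<lambda>u. f u * Dirichlet_kernel n u) has_integral I) {0..x + pi} \<and>
        (f \<longlongrightarrow> l) (at_right 0) \<and> \<bar>I - pi / 2 * l\<bar> \<le> \<epsilon> / 2)"
    using x \<open>0 < \<epsilon>\<close> monoD[OF \<open>mono v\<close>] B
    by (intro Dirichlet_integral_uniform[where B = B] mono_onI) auto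
  show ?thesis
    using right left
  proof (eventually_elim, intro allI impI)
    fix n f
    let ?D = "Dirichlet_kernel n"
    assume R: "\<forall>f. (\<forall>u\<in>{0<..pi - x}. \<bar>f u\<bar> \<le> M) \<and>
        (\<forall>t u. 0 < t \<and> t < u \<and> u \<le> pi - x \<longrightarrow> \<bar>f t - f u\<bar> \<le> v (x + u) - v (x + t)) \<longrightarrow>
        (\<exists>I l. ((\<lambda>u. f u * ?D u) has_integral I) {0..pi - x} \<and>
          (f \<longlongrightarrow> l) (at_right 0) \<and> \<bar>I - pi / 2 * l\<bar> \<le> \<epsilon> / 2)"
      and L: "\<forall>f. (\<forall>u\<in>{0<..x + pi}. \<bar>f u\<bar> \<le> M) \<and>
        (\<forall>t u. 0 < t \<and> t < u \<and> u \<le> x + pi \<longrightarrow> \<bar>f t - f u\<bar> \<le> - v (x - u) - - v (x - t)) \<longrightarrow>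
        (\<exists>I l. ((\<lambda>u. f u * ?D u) has_integral I) {0..x + pi} \<and>
          (f \<longlongrightarrow> l) (at_right 0) \<and> \<bar>I - pi / 2 * l\<bar> \<le> \<epsilon> / 2)"
      and f: "(\<forall>t\<in>{-pi..pi}. \<bar>f t\<bar> \<le> M) \<and>
        (\<forall>t t'. - pi \<le> t \<and> t < t' \<and> t' \<le> pi \<longrightarrow> \<bar>f t - f t'\<bar> \<le> v t' - v t)"
    have D: "?D (t - x) = ?D (x - t)" for t
      using Dirichlet_kernel_minus[of n "x - t"] by simp
    have "(\<forall>u\<in>{0<..pi - x}. \<bar>f (x + u)\<bar> \<le> M) \<and> (\<forall>t u. 0 < t \<and> t < u \<and> u \<le> pi - x \<longrightarrow>
        \<bar>f (x + t) - f (x + u)\<bar> \<le> v (x + u) - v (x + t))"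
      using f x by auto
    then obtain I p where I: "((\<lambda>u. f (x + u) * ?D u) has_integral I) {0..pi - x}"
      "((\<lambda>u. f (x + u)) \<longlongrightarrow> p) (at_right 0)" "\<bar>I - pi / 2 * p\<bar> \<le> \<epsilon> / 2"
      using R[rule_format, of "\<lambda>u. f (x + u)"] by blast
    have "(\<forall>u\<in>{0<..x + pi}. \<bar>f (x - u)\<bar> \<le> M) \<and> (\<forall>t u. 0 < t \<and> t < u \<and> u \<le> x + pi \<longrightarrow>
        \<bar>f (x - t) - f (x - u)\<bar> \<le> - v (x - u) - - v (x - t))"
    proof (intro conjI ballI allI impI)
      fix t u assume "0 < t \<and> t < u \<and> u \<le> x + pi"
      then show "\<bar>f (x - t) - f (x - u)\<bar> \<le> - v (x - u) - - v (x - t)"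
        using f[THEN conjunct2, rule_format, of "x - u" "x - t"] x by (simp add: abs_minus_commute)
    qed (use f x in auto)
    then obtain J q where J: "((\<lambda>u. f (x - u) * ?D u) has_integral J) {0..x + pi}"
      "((\<lambda>u. f (x - u)) \<longlongrightarrow> q) (at_right 0)" "\<bar>J - pi / 2 * q\<bar> \<le> \<epsilon> / 2"
      using L[rule_format, of "\<lambda>u. f (x - u)"] by blast
    have "((\<lambda>t. ?D (x - t) * f t) has_integral I) {x..pi}"
      using I(1) has_integral_shift_Icc_real[of "\<lambda>t. ?D (x - t) * f t" x I 0 "pi - x"]
      by (simp add: o_def mult.commute)
    moreover have "((\<lambda>u. f (x + u) * ?D u) has_integral J) {- (x + pi)..- 0}"
      using J(1) by (subst has_integral_reflect_real[symmetric]) (simp add: add.commute)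
    then have "((\<lambda>t. ?D (x - t) * f t) has_integral J) {-pi..x}"
      using has_integral_shift_Icc_real[of "\<lambda>t. ?D (x - t) * f t" x J "- (x + pi)" 0]
      by (simp add: o_def mult.commute)
    ultimately have "((\<lambda>t. ?D (x - t) * f t) has_integral J + I) {-pi..pi}"
      using x by (intro has_integral_combine[of "- pi" x pi]) auto
    moreover have "(f \<longlongrightarrow> p) (at_right x)"
      using I(2) by (subst filterlim_at_right_to_0) (simp add: add.commute)
    moreover have "(f \<longlongrightarrow> q) (at_left x)"
      using J(2) by (subst filterlim_at_left_to_right, subst filterlim_at_right_to_0) simp
    moreover have "\<bar>(J + I) - pi / 2 * (p + q)\<bar> \<le> \<epsilon>"
    proof -
      have "(J + I) - pi / 2 * (p + q) = (I - pi / 2 * p) + (J - pi / 2 * q)"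
        by (simp add: field_simps)
      then show ?thesis
        using abs_triangle_ineq[of "I - pi / 2 * p" "J - pi / 2 * q"] add_mono[OF I(3) J(3)] by simp
    qed
    ultimately show "\<exists>I p q. ((\<lambda>t. ?D (x - t) * f t) has_integral I) {-pi..pi} \<and>
        (f \<longlongrightarrow> p) (at_right x) \<and> (f \<longlongrightarrow> q) (at_left x) \<and> \<bar>I - pi / 2 * (p + q)\<bar> \<le> \<epsilon>"
      by blast
  qed
qed

text \<open>Every coordinate of every selection has the same bound \<open>M\<close> and is dominated
  by the same \<open>v\<close>, so one threshold serves all of them. The sum of the coordinate
  errors bounds the norm, which explains the division by the dimension.\<close>

lemma Dirichlet_Jordan_uniform_vector:
  fixes v :: "real \<Rightarrow> real" and S :: "(real \<Rightarrow> 'v::euclidean_space) set"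
  assumes "mono v" and x: "x \<in> {- pi<..<pi}" and "0 < \<epsilon>"
    and M: "\<And>s t. s \<in> S \<Longrightarrow> t \<in> {-pi..pi} \<Longrightarrow> norm (s t) \<le> M"
    and v: "\<And>s t t'. s \<in> S \<Longrightarrow> - pi \<le> t \<Longrightarrow> t < t' \<Longrightarrow> t' \<le> pi \<Longrightarrow> norm (s t - s t') \<le> v t' - v t"
  shows "\<forall>\<^sub>F n in sequentially. \<forall>s\<in>S.
    norm (integral {-pi..pi} (\<lambda>t. Dirichlet_kernel n (x - t) *\<^sub>R s t) -
      (pi / 2) *\<^sub>R (Lim (at_right x) s + Lim (at_left x) s)) \<le> \<epsilon>"
proof -
  have "0 < \<epsilon> / real DIM('v)" using \<open>0 < \<epsilon>\<close> by simp
  from Dirichlet_Jordan_uniform[OF \<open>mono v\<close> x this, of M] show ?thesis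
  proof (eventually_elim, intro ballI)
    fix n s
    let ?D = "Dirichlet_kernel n"
    assume *: "\<forall>f. (\<forall>t\<in>{-pi..pi}. \<bar>f t\<bar> \<le> M) \<and>
        (\<forall>t t'. - pi \<le> t \<and> t < t' \<and> t' \<le> pi \<longrightarrow> \<bar>f t - f t'\<bar> \<le> v t' - v t) \<longrightarrow>
        (\<exists>I p q. ((\<lambda>t. ?D (x - t) * f t) has_integral I) {-pi..pi} \<and>
          (f \<longlongrightarrow> p) (at_right x) \<and> (f \<longlongrightarrow> q) (at_left x) \<and>
          \<bar>I - pi / 2 * (p + q)\<bar> \<le> \<epsilon> / real DIM('v))"
      and s: "s \<in> S"
    have "\<forall>b\<in>Basis. \<exists>I p q. ((\<lambda>t. ?D (x - t) * (s t \<bullet> b)) has_integral I) {-pi..pi} \<and>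
        ((\<lambda>t. s t \<bullet> b) \<longlongrightarrow> p) (at_right x) \<and> ((\<lambda>t. s t \<bullet> b) \<longlongrightarrow> q) (at_left x) \<and>
        \<bar>I - pi / 2 * (p + q)\<bar> \<le> \<epsilon> / real DIM('v)"
    proof
      fix b :: 'v assume b: "b \<in> Basis"
      have "\<bar>s t \<bullet> b\<bar> \<le> M" if "t \<in> {-pi..pi}" for t
        using order_trans[OF Basis_le_norm[OF b] M[OF s that]] .
      moreover have "\<bar>s t \<bullet> b - s t' \<bullet> b\<bar> \<le> v t' - v t" if "- pi \<le> t" "t < t'" "t' \<le> pi" for t t'
        using order_trans[OF Basis_le_norm[OF b] v[OF s that]] by (simp add: inner_diff_left)
      ultimately show "\<exists>I p q. ((\<lambda>t. ?D (x - t) * (s t \<bullet> b)) has_integral I) {-pi..pi} \<and>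
        ((\<lambda>t. s t \<bullet> b) \<longlongrightarrow> p) (at_right x) \<and> ((\<lambda>t. s t \<bullet> b) \<longlongrightarrow> q) (at_left x) \<and>
        \<bar>I - pi / 2 * (p + q)\<bar> \<le> \<epsilon> / real DIM('v)"
        using *[rule_format, of "\<lambda>t. s t \<bullet> b"] by blast
    qed
    then obtain I p q where
      I: "\<And>b. b \<in> Basis \<Longrightarrow> ((\<lambda>t. ?D (x - t) * (s t \<bullet> b)) has_integral I b) {-pi..pi}"
      and p: "\<And>b. b \<in> Basis \<Longrightarrow> ((\<lambda>t. s t \<bullet> b) \<longlongrightarrow> p b) (at_right x)"
      and q: "\<And>b. b \<in> Basis \<Longrightarrow> ((\<lambda>t. s t \<bullet> b) \<longlongrightarrow> q b) (at_left x)"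
      and le: "\<And>b. b \<in> Basis \<Longrightarrow> \<bar>I b - pi / 2 * (p b + q b)\<bar> \<le> \<epsilon> / real DIM('v)"
      unfolding bchoice_iff by blast
    have vec: "(\<Sum>c\<in>Basis. g c *\<^sub>R c) \<bullet> b = g b" if "b \<in> Basis" for g and b :: 'v
      using that by simp
    have Iv: "integral {-pi..pi} (\<lambda>t. ?D (x - t) *\<^sub>R s t) = (\<Sum>b\<in>Basis. I b *\<^sub>R b)"
      using I by (intro integral_unique) (simp add: has_integral_componentwise_iff[of _ "\<Sum>b\<in>Basis. I b *\<^sub>R b"])
    have "(s \<longlongrightarrow> (\<Sum>b\<in>Basis. p b *\<^sub>R b)) (at_right x)"
      using p by (simp add: tendsto_componentwise_iff[of s])
    \<comment> \<open>The convergence just shown makes \<open>Lim\<close> a genuine limit and not an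
      arbitrary value.\<close>
    then have p': "Lim (at_right x) s = (\<Sum>b\<in>Basis. p b *\<^sub>R b)"
      by (intro tendsto_Lim) auto
    have "(s \<longlongrightarrow> (\<Sum>b\<in>Basis. q b *\<^sub>R b)) (at_left x)"
      using q by (simp add: tendsto_componentwise_iff[of s])
    then have q': "Lim (at_left x) s = (\<Sum>b\<in>Basis. q b *\<^sub>R b)"
      by (intro tendsto_Lim) auto
    let ?z = "integral {-pi..pi} (\<lambda>t. ?D (x - t) *\<^sub>R s t) -
      (pi / 2) *\<^sub>R (Lim (at_right x) s + Lim (at_left x) s)"
    have "norm ?z \<le> (\<Sum>b\<in>Basis. \<bar>?z \<bullet> b\<bar>)" by (rule norm_le_l1)
    also have "\<dots> \<le> (\<Sum>b\<in>(Basis :: 'v set). \<epsilon> / real DIM('v))"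
      using le by (intro sum_mono) (simp add: Iv p' q' inner_diff_left inner_add_left vec)
    also have "\<dots> = \<epsilon>" by simp
    finally show "norm ?z \<le> \<epsilon>" .
  qed
qed

theorem theorem6p18:
  fixes N :: "real ^ 'd \<Rightarrow> real"
    and F :: "real \<Rightarrow> (real ^ 'd) set"
    and x :: real
  assumes "is_norm N"
    and "F \<in> BV_compact_graph N (- pi) pi"
    and "x \<in> {- pi<..<pi}"
  shows "(\<lambda>n. haus N (metric_Fourier N F n x) (Fourier_limit_set N F x)) \<longlonglongrightarrow> 0"
proof -
  note N = assms(1) and F = assms(2) and x = assms(3)
  let ?S = "metric_selections N (- pi) pi F"
  have "- pi < pi" using pi_gt_zero by linarith
  obtain v where v: "mono v" "\<And>s t t'. s \<in> ?S \<Longrightarrow> - pi \<le> t \<Longrightarrow> t < t' \<Longrightarrow> t' \<le> pi \<Longrightarrow>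
      norm (s t - s t') \<le> v t' - v t"
    using metric_selections_control[OF N F \<open>- pi < pi\<close>] by blast
  obtain M where M: "\<And>t y. t \<in> {-pi..pi} \<Longrightarrow> y \<in> F t \<Longrightarrow> norm y \<le> M"
    using BV_compact_graph_bounded[OF F] by blast
  have bdd: "norm (s t) \<le> M" if "s \<in> ?S" "t \<in> {-pi..pi}" for s t
    using that by (intro M[OF that(2)]) (auto simp: metric_selections_def)
  define f where
    "f n s = (1 / pi) *\<^sub>R integral {-pi..pi} (\<lambda>t. Dirichlet_kernel n (x - t) *\<^sub>R s t)"
    for n and s :: "real \<Rightarrow> real ^ 'd"
  define g where "g s = (1 / 2) *\<^sub>R (Lim (at_right x) s + Lim (at_left x) s)"
    for s :: "real \<Rightarrow> real ^ 'd"
  have Fourier: "metric_Fourier N F n x = f n ` ?S" for n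
    unfolding metric_Fourier_def f_def
    by (subst weighted_metric_integral_eq[OF N F]) (auto intro!: continuous_intros simp: image_image)
  have limit: "Fourier_limit_set N F x = g ` ?S"
    unfolding Fourier_limit_set_def g_def by blast
  have nonneg: "0 \<le> haus N (f n ` ?S) (g ` ?S)" for n
    using metric_selections_nonempty[OF N F \<open>- pi < pi\<close>] by (intro haus_nonneg[OF N]) auto
  obtain K where K: "K > 0" "\<And>z. N z \<le> K * norm z" using is_norm_le_norm[OF N] by blast
  have "\<forall>\<^sub>F n in sequentially. haus N (f n ` ?S) (g ` ?S) \<le> ereal \<epsilon>" if "0 < \<epsilon>" for \<epsilon>
  proof -
    \<comment> \<open>The factor pi cancels the normalisation of the Fourier series, and
      \<open>K\<close> pays for passing from \<open>norm\<close> to \<open>N\<close>.\<close>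
    have "0 < \<epsilon> * pi / K" using that K(1) by simp
    then have "\<forall>\<^sub>F n in sequentially. \<forall>s\<in>?S.
        norm (integral {-pi..pi} (\<lambda>t. Dirichlet_kernel n (x - t) *\<^sub>R s t) -
          (pi / 2) *\<^sub>R (Lim (at_right x) s + Lim (at_left x) s)) \<le> \<epsilon> * pi / K"
      using bdd v(2) by (intro Dirichlet_Jordan_uniform_vector[OF v(1) x]) auto
    then show ?thesis
    proof eventually_elim
      case (elim n)
      show ?case
      proof (rule haus_image_le[OF N])
        fix s assume "s \<in> ?S"
        let ?z = "integral {-pi..pi} (\<lambda>t. Dirichlet_kernel n (x - t) *\<^sub>R s t) -
          (pi / 2) *\<^sub>R (Lim (at_right x) s + Lim (at_left x) s)"
        have eq: "f n s - g s = (1 / pi) *\<^sub>R ?z"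
          by (simp add: f_def g_def scaleR_diff_right)
        have "N (f n s - g s) \<le> K * (norm ?z / pi)"
          unfolding eq using K(2)[of "(1 / pi) *\<^sub>R ?z"] by simp
        also have "\<dots> \<le> K * ((\<epsilon> * pi / K) / pi)"
          using elim \<open>s \<in> ?S\<close> K(1) by (intro mult_left_mono divide_right_mono) auto
        also have "\<dots> = \<epsilon>" using K(1) by simp
        finally show "N (f n s - g s) \<le> \<epsilon>" .
      qed
    qed
  qed
  note eventually_le = this
  show ?thesis
    unfolding Fourier limit
  proof (rule order_tendstoI)
    fix a :: ereal assume "a < 0"
    then show "\<forall>\<^sub>F n in sequentially. a < haus N (f n ` ?S) (g ` ?S)"
      by (intro always_eventually allI less_le_trans[OF _ nonneg])
  next
    fix a :: ereal assume "0 < a"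
    then obtain \<epsilon> where "0 < ereal \<epsilon>" "ereal \<epsilon> < a"
      using ereal_dense2[of 0 a] by blast
    then show "\<forall>\<^sub>F n in sequentially. haus N (f n ` ?S) (g ` ?S) < a"
      by (intro eventually_mono[OF eventually_le[of \<epsilon>]]) auto
  qed
qed

end
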